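(* Let $m\in\mathbb{N}^*$, $a\in\mathbb{R}$, $I_f\in\mathbb{I}_{a+}$, let $\Omega$ be a nonempty open subset of $\mathbb{R}^m$, let $f:\Omega\times I_f\to\mathbb{R}^m$ be a Carathéodory function, let $q_a\in\Omega$ and $\alpha=(\alpha_1,\dots,\alpha_m)\in(0,1]^m$. Assume that: (i) for any compact $K\subset\Omega$ and any $[c,d]\subset I_f$ there exists $M\ge0$ such that $|f(x,t)|_m\le M$ for any $x\in K$ and for almost every $t\in[c,d]$; (ii) for every $(x,t)\in\Omega\times I_f$ there exist $R>0$, $\delta>0$ and $L\ge0$ such that $\overline{\mathrm{B}}_m(x,R)\subset\Omega$ and $|f(x_2,\tau)-f(x_1,\tau)|_m\le L|x_2-x_1|_m$ for any $x_1,x_2\in\overline{\mathrm{B}}_m(x,R)$ and for almost every $\tau\in[t-\delta,t+\delta]\cap I_f$. Let $(q,I)$ be the maximal solution of the Cauchy problem $${}_{\mathrm c}\mathrm{D}^\alpha_{a+}[q](t)=f(q(t),t),\qquad q(a)=q_a.$$ Then: - either $I=I_f$, that is, $(q,I)$ is global; - or $I=[a,b)$ with $b\in I_f$, $b>a$, and moreover, for every compact subset $K$ of $\Omega$, there exists $t\in I$ such that $q(t)\notin K$.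
   Context: $\mathbb{N}^*$ is the set of positive integers, $|\cdot|_m$ is the Euclidean norm of $\mathbb{R}^m$, $\overline{\mathrm{B}}_m(x,R)$ is the closed ball of $\mathbb{R}^m$ with center $x$ and radius $R$. For $a\in\mathbb{R}$, $\mathbb{I}_{a+}$ denotes the set of intervals $I\subset\mathbb{R}$ with $\{a\}\subsetneq I\subset[a,+\infty)$ (not necessarily compact). $\mathrm{L}^1_{\mathrm{loc}}(I)$ (resp. $\mathrm{AC}_{\mathrm{loc}}(I)$) is the set of functions on $I$ that are integrable (resp. absolutely continuous) on every compact subinterval of $I$; $\mathrm{C}(I)$ is the set of continuous functions. Left fractional operators. Let $I\in\mathbb{I}_{a+}$ and $q\in \mathrm{L}^1_{\mathrm{loc}}(I,\mathbb{R})$. For a real $\alpha>0$, $\mathrm{I}^\alpha_{a+}[q](t):=\int_a^t\frac{1}{\Gamma(\alpha)}(t-\tau)^{\alpha-1}q(\tau)\,d\tau$ (defined for a.e. $t\in I$), and $\mathrm{I}^0_{a+}[q]:=q$; if $\mathrm{I}^\alpha_{a+}[q]$ is a.e. equal to a continuous function, it is identified with it. For $0\le\alpha\le1$, $\mathrm{AC}^\alpha_{a+}(I,\mathbb{R})$ is the set of $q\in \mathrm{L}^1_{\mathrm{loc}}(I,\mathbb{R})$ with $\mathrm{I}^{1-\alpha}_{a+}[q]\in\mathrm{AC}_{\mathrm{loc}}(I,\mathbb{R})$, and then $\mathrm{D}^\alpha_{a+}[q]:=\frac{d}{dt}\mathrm{I}^{1-\alpha}_{a+}[q]$ a.e. on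 $I$. ${}_{\mathrm c}\mathrm{AC}^\alpha_{a+}(I,\mathbb{R})$ is the set of $q\in\mathrm{C}(I,\mathbb{R})$ with $q-q(a)\in\mathrm{AC}^\alpha_{a+}(I,\mathbb{R})$, and then ${}_{\mathrm c}\mathrm{D}^\alpha_{a+}[q]:=\mathrm{D}^\alpha_{a+}[q-q(a)]$. For vector functions $q=(q_i)$ and a multi-order $\alpha=(\alpha_i)$ everything is taken componentwise, the $i$-th component with order $\alpha_i$; ${}_{\mathrm c}\mathrm{AC}^\alpha_{a+}(I,\Omega)$ consists of those functions with values in $\Omega$. A local solution of the Cauchy problem is a couple $(q,I)$ with $I\in\mathbb{I}_{a+}$, $I\subset I_f$, $q\in{}_{\mathrm c}\mathrm{AC}^\alpha_{a+}(I,\Omega)$, $q(a)=q_a$ and ${}_{\mathrm c}\mathrm{D}^\alpha_{a+}[q](t)=f(q(t),t)$ for a.e. $t\in I$. A couple $(q',I')$ is an extension of a local solution $(q,I)$ if $(q',I')$ is a local solution, $I\subset I'$ and $q'=q$ on $I$. A local solution $(q,I)$ is maximal if $I'=I$ for every extension $(q',I')$ of $(q,I)$, and global if $I=I_f$. Under assumptions (i) and (ii) of the claim a maximal solution exists and is unique. *)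

theory Defs
  imports "HOL-Analysis.Analysis"
begin

(* Functions on an interval are total functions of which only the values on the
   interval matter; "almost every" refers to Lebesgue measure on that interval. *)

definition intervals_from :: "real \<Rightarrow> real set set" where
  "intervals_from a = {I. is_interval I \<and> {a} \<subset> I \<and> I \<subseteq> {a..}}"

definition L1_loc :: "real set \<Rightarrow> (real \<Rightarrow> real) set" where
  "L1_loc I = {q. \<forall>c d. {c..d} \<subseteq> I \<longrightarrow> q absolutely_integrable_on {c..d}}"

definition abs_cont_on :: "real \<Rightarrow> real \<Rightarrow> (real \<Rightarrow> real) \<Rightarrow> bool" where
  "abs_cont_on c d g \<longleftrightarrow>
     (\<forall>\<epsilon>>0. \<exists>\<delta>>0. \<forall>D :: (real \<times> real) set.
        finite D \<and> (\<forall>(u, v)\<in>D. c \<le> u \<and> u \<le> v \<and> v \<le> d) \<and>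
        pairwise (\<lambda>(u, v) (u', v'). {u<..<v} \<inter> {u'<..<v'} = {}) D \<and>
        (\<Sum>(u, v)\<in>D. v - u) < \<delta> \<longrightarrow>
        (\<Sum>(u, v)\<in>D. \<bar>g v - g u\<bar>) < \<epsilon>)"

definition AC_loc :: "real set \<Rightarrow> (real \<Rightarrow> real) set" where
  "AC_loc I = {g. \<forall>c d. {c..d} \<subseteq> I \<longrightarrow> abs_cont_on c d g}"

definition rl_integral_raw :: "real \<Rightarrow> real \<Rightarrow> (real \<Rightarrow> real) \<Rightarrow> real \<Rightarrow> real" where
  "rl_integral_raw \<beta> a q t =
     (if \<beta> = 0 then q t
      else LINT \<tau>:{a..t}|lebesgue. 1 / Gamma \<beta> * (t - \<tau>) powr (\<beta> - 1) * q \<tau>)"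

(* The Riemann-Liouville integral on I, identified with its continuous
   representative whenever there is one; on a nondegenerate interval that
   representative is unique, so the choice is immaterial on I. *)
definition rl_integral :: "real \<Rightarrow> real \<Rightarrow> real set \<Rightarrow> (real \<Rightarrow> real) \<Rightarrow> real \<Rightarrow> real" where
  "rl_integral \<beta> a I q =
     (let is_rep = (\<lambda>g. continuous_on I g \<and> (AE t in lebesgue_on I. g t = rl_integral_raw \<beta> a q t))
      in if \<exists>g. is_rep g then SOME g. is_rep g else rl_integral_raw \<beta> a q)"

definition rl_AC :: "real \<Rightarrow> real \<Rightarrow> real set \<Rightarrow> (real \<Rightarrow> real) set" where
  "rl_AC \<alpha> a I = {q \<in> L1_loc I. rl_integral (1 - \<alpha>) a I q \<in> AC_loc I}"

(* The derivatives exist only almost everywhere, so they are relations: the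
   derivative of q exists at t and equals y. *)
definition has_rl_derivative ::
    "real \<Rightarrow> real \<Rightarrow> real set \<Rightarrow> (real \<Rightarrow> real) \<Rightarrow> real \<Rightarrow> real \<Rightarrow> bool" where
  "has_rl_derivative \<alpha> a I q y t \<longleftrightarrow>
     (rl_integral (1 - \<alpha>) a I q has_real_derivative y) (at t within I)"

definition caputo_AC :: "real \<Rightarrow> real \<Rightarrow> real set \<Rightarrow> (real \<Rightarrow> real) set" where
  "caputo_AC \<alpha> a I = {q. continuous_on I q \<and> (\<lambda>t. q t - q a) \<in> rl_AC \<alpha> a I}"

definition has_caputo_derivative ::
    "real \<Rightarrow> real \<Rightarrow> real set \<Rightarrow> (real \<Rightarrow> real) \<Rightarrow> real \<Rightarrow> real \<Rightarrow> bool" where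
  "has_caputo_derivative \<alpha> a I q y t \<longleftrightarrow> has_rl_derivative \<alpha> a I (\<lambda>s. q s - q a) y t"

definition caputo_AC_vec ::
    "real ^ 'n \<Rightarrow> real \<Rightarrow> real set \<Rightarrow> (real ^ 'n) set \<Rightarrow> (real \<Rightarrow> real ^ 'n) set" where
  "caputo_AC_vec \<alpha> a I \<Omega> =
     {q. (\<forall>i. (\<lambda>t. q t $ i) \<in> caputo_AC (\<alpha> $ i) a I) \<and> (\<forall>t\<in>I. q t \<in> \<Omega>)}"

definition has_caputo_derivative_vec ::
    "real ^ 'n \<Rightarrow> real \<Rightarrow> real set \<Rightarrow> (real \<Rightarrow> real ^ 'n) \<Rightarrow> real ^ 'n \<Rightarrow> real \<Rightarrow> bool" where
  "has_caputo_derivative_vec \<alpha> a I q y t \<longleftrightarrow>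
     (\<forall>i. has_caputo_derivative (\<alpha> $ i) a I (\<lambda>s. q s $ i) (y $ i) t)"

definition caratheodory ::
    "(real ^ 'n) set \<Rightarrow> real set \<Rightarrow> (real ^ 'n \<Rightarrow> real \<Rightarrow> real ^ 'n) \<Rightarrow> bool" where
  "caratheodory \<Omega> J f \<longleftrightarrow>
     (AE t in lebesgue_on J. continuous_on \<Omega> (\<lambda>x. f x t)) \<and>
     (\<forall>x\<in>\<Omega>. f x \<in> borel_measurable (lebesgue_on J))"

(* Cauchy problem with data: state domain \<Omega>, time interval J, right-hand side f,
   multi-order \<alpha>, initial time a and initial value qa. *)
definition local_solution ::
    "(real ^ 'n) set \<Rightarrow> real set \<Rightarrow> (real ^ 'n \<Rightarrow> real \<Rightarrow> real ^ 'n) \<Rightarrow> real ^ 'n \<Rightarrow>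
     real \<Rightarrow> real ^ 'n \<Rightarrow> (real \<Rightarrow> real ^ 'n) \<Rightarrow> real set \<Rightarrow> bool" where
  "local_solution \<Omega> J f \<alpha> a qa q I \<longleftrightarrow>
     I \<in> intervals_from a \<and> I \<subseteq> J \<and> q \<in> caputo_AC_vec \<alpha> a I \<Omega> \<and> q a = qa \<and>
     (AE t in lebesgue_on I. has_caputo_derivative_vec \<alpha> a I q (f (q t) t) t)"

definition maximal_solution ::
    "(real ^ 'n) set \<Rightarrow> real set \<Rightarrow> (real ^ 'n \<Rightarrow> real \<Rightarrow> real ^ 'n) \<Rightarrow> real ^ 'n \<Rightarrow>
     real \<Rightarrow> real ^ 'n \<Rightarrow> (real \<Rightarrow> real ^ 'n) \<Rightarrow> real set \<Rightarrow> bool" where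
  "maximal_solution \<Omega> J f \<alpha> a qa q I \<longleftrightarrow>
     local_solution \<Omega> J f \<alpha> a qa q I \<and>
     (\<forall>q' I'. local_solution \<Omega> J f \<alpha> a qa q' I' \<and> I \<subseteq> I' \<and> (\<forall>t\<in>I. q' t = q t) \<longrightarrow> I' = I)"

end

theory Submission
  imports Defs
begin

text \<open>
  A function solves the Cauchy problem on an interval exactly if it is continuous, stays in the
  domain and satisfies the Volterra equation obtained by fractional integration. This uses the
  composition rule for Riemann--Liouville integrals, the fundamental theorem of calculus
  for absolutely continuous functions, and Lebesgue's differentiation theorem. Fractional integrals
  of essentially bounded functions are Hoelder continuous, so a solution on \<open>[a, b)\<close> that
  stays in a compact subset of the domain extends continuously, hence as a solution, to \<open>b\<close>. A solution on
  \<open>[a, b]\<close> with \<open>b\<close> not the last point of the time interval extends beyond \<open>b\<close>: with the past on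
  \<open>[a, b]\<close> frozen, the Volterra operator is a contraction on the continuous functions on a short
  interval \<open>[b, b + h]\<close> that start at \<open>q b\<close> and stay near it.
\<close>

text \<open>The fractional equation has memory: a solution at \<open>t\<close> depends on all its
  values on \<open>[a, t]\<close>, so it cannot be restarted at \<open>b\<close> as a new Cauchy
  problem of the same kind. Every estimate therefore keeps the base point \<open>a\<close>. A second
  obstacle lies in the hypotheses on \<open>f\<close>: their exceptional null sets may depend on the
  state, or on a pair of states, while the state of a solution moves with time. A countable dense
  set of states and continuity in the state merge them into one null set. Third,
  \<open>rl_integral\<close> selects its representative by choice; the computations use
  \<open>rl_integral_raw\<close> and return to the representative through the fact that continuous
  functions agreeing almost everywhere on a nondegenerate interval are equal. Since the components
  have different orders, the smallness conditions on a time step are imposed on a sum of powers of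
  its length.\<close>

section \<open>The fundamental theorem of calculus in one variable\<close>

text \<open>The gauge is differentiability off \<open>N\<close> and a small open cover of \<open>N\<close> on \<open>N\<close>; absolute
  continuity controls the intervals tagged in \<open>N\<close>.\<close>
lemma abs_cont_on_has_integral:
  fixes F g :: "real \<Rightarrow> real"
  assumes ab: "a \<le> b" and F: "abs_cont_on a b F" and N: "negligible N"
    and der: "\<And>x. x \<in> {a..b} - N \<Longrightarrow> (F has_real_derivative g x) (at x within {a..b})"
  shows "(g has_integral (F b - F a)) {a..b}"
proof -
  \<comment> \<open>On \<open>N\<close> nothing is known about \<open>g\<close>. With the value 0
    there, a tag in \<open>N\<close> contributes only the increment of \<open>F\<close>, which
    absolute continuity controls.\<close>
  define h where "h x = (if x \<in> N then 0 else g x)" for x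
  have "(h has_integral (F b - F a)) {a..b}"
    unfolding has_integral_real
  proof (intro allI impI)
    fix e :: real assume e: "e > 0"
    \<comment> \<open>The summand 1 admits \<open>a = b\<close> and makes the bound
      \<open>e1 * (b - a) < e / 2\<close> strict.\<close>
    define e1 where "e1 = e / (2 * (b - a + 1))"
    have e1: "e1 > 0" "e1 * (b - a) < e / 2"
      using e ab by (auto simp: e1_def field_simps)
    obtain \<delta> where \<delta>: "\<delta> > 0" and ac: "\<And>D :: (real \<times> real) set. finite D \<Longrightarrow>
        \<forall>(u, v)\<in>D. a \<le> u \<and> u \<le> v \<and> v \<le> b \<Longrightarrow>
        pairwise (\<lambda>(u, v) (u', v'). {u<..<v} \<inter> {u'<..<v'} = {}) D \<Longrightarrow>
        (\<Sum>(u, v)\<in>D. v - u) < \<delta> \<Longrightarrow> (\<Sum>(u, v)\<in>D. \<bar>F v - F u\<bar>) < e / 2"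
      using F e unfolding abs_cont_on_def by (metis (no_types, lifting) half_gt_zero)
    obtain U where U: "open U" "N \<subseteq> U" "U \<in> lmeasurable" "measure lebesgue U < \<delta>"
    proof -
      have Nm: "N \<in> lmeasurable" "measure lebesgue N = 0"
        using N by (auto simp: negligible_iff_measure)
      then obtain T where T: "open T" "N \<subseteq> T" "T - N \<in> lmeasurable" "emeasure lebesgue (T - N) < ennreal \<delta>"
        using sets_lebesgue_outer_open[OF fmeasurableD[OF Nm(1)] \<delta>] by blast
      have "T = (T - N) \<union> N" using T(2) by auto
      then have "T \<in> lmeasurable" by (metis T(3) Nm(1) fmeasurable.Un)
      moreover have "measure lebesgue T = measure lebesgue (T - N)"
        using \<open>T \<in> lmeasurable\<close> N by (simp add: measure_Diff_null_set negligible_iff_null_sets)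
      moreover have "measure lebesgue (T - N) < \<delta>"
        using T(3,4) \<delta> by (simp add: emeasure_eq_measure2 ennreal_less_iff)
      ultimately show ?thesis using that T by simp
    qed
    have "\<exists>d>0. x \<in> {a..b} - N \<longrightarrow> (\<forall>y\<in>{a..b}. \<bar>y - x\<bar> < d \<longrightarrow> \<bar>F y - F x - g x * (y - x)\<bar> \<le> e1 * \<bar>y - x\<bar>)" for x
    proof (cases "x \<in> {a..b} - N")
      case True
      from der[OF True] have "(F has_derivative (*) (g x)) (at x within {a..b})"
        by (simp add: has_field_derivative_def)
      then show ?thesis using e1(1) unfolding has_derivative_within_alt
        by (metis real_norm_def)
    qed (use zero_less_one in blast)
    then obtain d where d: "\<And>x. d x > 0"
      "\<And>x y. x \<in> {a..b} - N \<Longrightarrow> y \<in> {a..b} \<Longrightarrow> \<bar>y - x\<bar> < d x \<Longrightarrow> \<bar>F y - F x - g x * (y - x)\<bar> \<le> e1 * \<bar>y - x\<bar>"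
      by metis
    define \<gamma> where "\<gamma> x = (if x \<in> N then U else ball x (d x))" for x
    have "gauge \<gamma>" using U d by (auto simp: gauge_def \<gamma>_def)
    moreover have "norm ((\<Sum>(x,k)\<in>p. measure lborel k *\<^sub>R h x) - (F b - F a)) < e"
      if p: "p tagged_division_of {a..b}" and fine: "\<gamma> fine p" for p
    proof -
      have finp: "finite p" using p by blast
      define \<Delta> where "\<Delta> k = F (Sup k) - F (Inf k)" for k
      have k: "x \<in> {Inf K..Sup K}" "K = {Inf K..Sup K}" "Inf K \<le> Sup K" "a \<le> Inf K" "Sup K \<le> b"
         "measure lborel K = Sup K - Inf K" "K \<subseteq> \<gamma> x"
        if xKp: "(x, K) \<in> p" for x K
      proof -
        obtain u v where uv: "K = {u..v}" and x: "x \<in> K" and sub: "K \<subseteq> {a..b}"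
          using tagged_division_ofD(2-4)[OF p xKp] by (metis box_real(2))
        then have "u \<le> v" by auto
        then have "Inf K = u" "Sup K = v" using uv by auto
        then show "x \<in> {Inf K..Sup K}" "K = {Inf K..Sup K}" "Inf K \<le> Sup K" "a \<le> Inf K" "Sup K \<le> b"
           "measure lborel K = Sup K - Inf K" "K \<subseteq> \<gamma> x"
          using uv x sub \<open>u \<le> v\<close> fine xKp by (auto simp: fine_def)
      qed
      have tel: "(\<Sum>(x,k)\<in>p. \<Delta> k) = F b - F a"
        using additive_tagged_division_1[OF ab p] by (simp add: \<Delta>_def)
      \<comment> \<open>Degenerate intervals contribute nothing. Without them the map
        \<open>w\<close>, which forgets the tags, is injective: two tags on the same nondegenerate
        interval would contradict disjoint interiors.\<close>
      define p1 where "p1 = {(x,k)\<in>p. x \<in> N \<and> measure lborel k \<noteq> 0}"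
      define w where "w xk = (case xk of (x::real, k::real set) \<Rightarrow> (Inf k, Sup k))" for xk
      have inj: "inj_on w p1"
      proof (rule inj_onI)
        fix i j assume ij: "i \<in> p1" "j \<in> p1" "w i = w j"
        obtain x K y L where i: "i = (x, K)" "j = (y, L)" by (metis surj_pair)
        then have p': "(x, K) \<in> p" "(y, L) \<in> p" "measure lborel K \<noteq> 0" using ij by (auto simp: p1_def)
        have "K = L" using ij i k(2)[OF p'(1)] k(2)[OF p'(2)] by (auto simp: w_def)
        have "interior K \<noteq> {}"
          by (metis k(2) p'(1,3) content_real_eq_0 interior_atLeastAtMost_real greaterThanLessThan_empty_iff2)
        then show "i = j" using tagged_division_ofD(5)[OF p p'(1,2)] \<open>K = L\<close> i by auto
      qed
      have D_bound: "(\<Sum>(u, v)\<in>w ` p1. \<bar>F v - F u\<bar>) < e / 2"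
      proof (rule ac)
        show "finite (w ` p1)" using finp by (auto simp: p1_def intro: finite_subset[of _ p])
        then have fin: "finite (w ` p1)" .
        show "\<forall>(u, v)\<in>w ` p1. a \<le> u \<and> u \<le> v \<and> v \<le> b"
          using k by (fastforce simp: p1_def w_def)
        show pw: "pairwise (\<lambda>(u, v) (u', v'). {u<..<v} \<inter> {u'<..<v'} = {}) (w ` p1)"
        proof (rule pairwiseI)
          fix r s assume "r \<in> w ` p1" "s \<in> w ` p1" "r \<noteq> s"
          then obtain x K y L where *: "(x, K) \<in> p" "(y, L) \<in> p" "r = (Inf K, Sup K)" "s = (Inf L, Sup L)"
            by (auto simp: p1_def w_def)
          then have "(x, K) \<noteq> (y, L)" using \<open>r \<noteq> s\<close> by auto
          then have "interior K \<inter> interior L = {}" using tagged_division_ofD(5)[OF p *(1,2)] by blast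
          then have "{Inf K<..<Sup K} \<inter> {Inf L<..<Sup L} = {}"
            by (metis k(2)[OF *(1)] k(2)[OF *(2)] interior_atLeastAtMost_real)
          then show "(case r of (u, v) \<Rightarrow> \<lambda>(u', v'). {u<..<v} \<inter> {u'<..<v'} = {}) s" using * by simp
        qed
        have "(\<Sum>(u, v)\<in>w ` p1. v - u) = (\<Sum>i\<in>w ` p1. measure lebesgue {fst i<..<snd i})"
          by (intro sum.cong) (auto simp: p1_def w_def dest: k(3))
        also have "\<dots> = measure lebesgue (\<Union>i\<in>w ` p1. {fst i<..<snd i})"
        proof (rule measure_finite_Union[symmetric, OF fin])
          show "disjoint_family_on (\<lambda>i. {fst i<..<snd i}) (w ` p1)"
            using pw by (auto simp: disjoint_family_on_def pairwise_def split_def)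
        next
          show "(\<lambda>i. {fst i<..<snd i}) ` (w ` p1) \<subseteq> sets lebesgue" by auto
        next
          fix i assume "i \<in> w ` p1"
          have "{fst i<..<snd i} \<in> lmeasurable" using lmeasurable_box[of "fst i" "snd i"] by simp
          then show "emeasure lebesgue {fst i<..<snd i} \<noteq> \<infinity>" using fmeasurableD2 by fastforce
        qed
        also have "\<dots> \<le> measure lebesgue U"
        proof (rule measure_mono_fmeasurable)
          show "(\<Union>i\<in>w ` p1. {fst i<..<snd i}) \<in> sets lebesgue"
            using fin by (intro sets.finite_UN) auto
          show "(\<Union>i\<in>w ` p1. {fst i<..<snd i}) \<subseteq> U"
          proof clarsimp
            fix x K z assume "(x, K) \<in> p1" "fst (w (x, K)) < z" "z < snd (w (x, K))"
            then have "z \<in> {Inf K..Sup K}" "(x, K) \<in> p" "x \<in> N" by (auto simp: p1_def w_def)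
            then show "z \<in> U" using k(2,7)[of x K] by (auto simp: \<gamma>_def)
          qed
        qed (use U in auto)
        finally show "(\<Sum>(u, v)\<in>w ` p1. v - u) < \<delta>" using U by simp
      qed
      have "(\<Sum>(x,k)\<in>p. measure lborel k *\<^sub>R h x) - (F b - F a) = (\<Sum>(x,k)\<in>p. measure lborel k * h x - \<Delta> k)"
        unfolding tel[symmetric] by (simp add: sum_subtractf split_def)
      also have "\<bar>\<dots>\<bar> \<le> (\<Sum>(x,k)\<in>p. \<bar>measure lborel k * h x - \<Delta> k\<bar>)"
        by (simp add: split_def sum_abs)
      also have "\<dots> \<le> (\<Sum>(x,k)\<in>p. e1 * measure lborel k + (if (x,k) \<in> p1 then \<bar>\<Delta> k\<bar> else 0))"
      proof (rule sum_mono, clarsimp, intro conjI impI)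
        fix x K assume xK: "(x, K) \<in> p"
        note kk = k[OF xK]
        show "\<bar>measure lborel K * h x - \<Delta> K\<bar> \<le> e1 * measure lborel K + \<bar>\<Delta> K\<bar>" if "(x, K) \<in> p1"
          using that e1(1) by (auto simp: p1_def h_def)
        show "\<bar>measure lborel K * h x - \<Delta> K\<bar> \<le> e1 * measure lborel K" if "(x, K) \<notin> p1"
        proof (cases "x \<in> N")
          case True
          then have "measure lborel K = 0" using that xK by (auto simp: p1_def)
          then show ?thesis using kk by (simp add: \<Delta>_def)
        next
          case False
          then have x: "x \<in> {a..b} - N" using kk(1,3,4,5) by auto
          have "K \<subseteq> ball x (d x)" using kk False by (simp add: \<gamma>_def)
          moreover have "Inf K \<in> K" "Sup K \<in> K" using kk by (metis atLeastAtMost_iff order_refl)+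
          ultimately have "\<bar>Inf K - x\<bar> < d x" "\<bar>Sup K - x\<bar> < d x" by (auto simp: dist_real_def)
          then have "\<bar>F (Inf K) - F x - g x * (Inf K - x)\<bar> \<le> e1 * \<bar>Inf K - x\<bar>"
             "\<bar>F (Sup K) - F x - g x * (Sup K - x)\<bar> \<le> e1 * \<bar>Sup K - x\<bar>"
            using d(2)[OF x] kk by auto
          \<comment> \<open>Straddle argument: the tag lies between the endpoints, so the two error
            lengths add up to exactly the length of \<open>K\<close>.\<close>
          moreover have "\<bar>Inf K - x\<bar> = x - Inf K" "\<bar>Sup K - x\<bar> = Sup K - x" using kk(1,3,4,5) by auto
          ultimately have "\<bar>g x * (Sup K - Inf K) - \<Delta> K\<bar> \<le> e1 * (Sup K - Inf K)"
            unfolding \<Delta>_def by (simp add: algebra_simps)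
          then show ?thesis using False kk by (simp add: h_def mult.commute)
        qed
      qed
      also have "\<dots> = e1 * (\<Sum>(x,k)\<in>p. measure lborel k) + (\<Sum>(x,k)\<in>p. if (x,k) \<in> p1 then \<bar>\<Delta> k\<bar> else 0)"
        by (simp add: sum.distrib sum_distrib_left split_def)
      also have "(\<Sum>(x,k)\<in>p. measure lborel k) = b - a"
        using additive_content_tagged_division[of p a b] p ab by simp
      also have "(\<Sum>(x,k)\<in>p. if (x,k) \<in> p1 then \<bar>\<Delta> k\<bar> else 0) = (\<Sum>(x,k)\<in>p1. \<bar>\<Delta> k\<bar>)"
        using finp by (intro sum.mono_neutral_cong_right) (auto simp: p1_def split: if_splits)
      also have "\<dots> = (\<Sum>(u, v)\<in>w ` p1. \<bar>F v - F u\<bar>)"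
        unfolding sum.reindex[OF inj] by (intro sum.cong) (auto simp: w_def \<Delta>_def)
      finally show ?thesis using D_bound e1(2) by simp
    qed
    ultimately show "\<exists>\<gamma>. gauge \<gamma> \<and> (\<forall>p. p tagged_division_of {a..b} \<and> \<gamma> fine p \<longrightarrow>
        norm ((\<Sum>(x,k)\<in>p. measure lborel k *\<^sub>R h x) - (F b - F a)) < e)"
      by (intro exI[of _ \<gamma>] conjI allI impI) simp_all
  qed
  then show ?thesis
    by (rule has_integral_spike[OF N, rotated]) (auto simp: h_def)
qed

text \<open>Bad intervals at points of non-differentiability form a Vitali cover; on disjoint ones the
  Henstock lemma bounds the total length.\<close>
lemma negligible_not_derivative_integral:
  fixes g :: "real \<Rightarrow> real"
  assumes g: "g integrable_on {a..b}"
  shows "negligible {x \<in> {a..b}. \<not> ((\<lambda>t. integral {a..t} g) has_real_derivative g x) (at x within {a..b})}"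
proof -
  define G where "G t = integral {a..t} g" for t
  define bad where "bad \<eta> x y \<longleftrightarrow> y \<in> {a..b} \<and> y \<noteq> x \<and> \<bar>G y - G x - g x * (y - x)\<bar> > \<eta> * \<bar>y - x\<bar>" for \<eta> x y
  \<comment> \<open>The failure of differentiability is graded by its size, so that countably many
    sets \<open>E n\<close> cover the exceptional set.\<close>
  define E where "E n = {x \<in> {a..b}. \<forall>d>0. \<exists>y. \<bar>y - x\<bar> < d \<and> bad (inverse (real (Suc n))) x y}" for n
  have "{x \<in> {a..b}. \<not> (G has_real_derivative g x) (at x within {a..b})} \<subseteq> (\<Union>n. E n)"
  proof clarify
    fix x assume x: "x \<in> {a..b}" "\<not> (G has_real_derivative g x) (at x within {a..b})"
    show "x \<in> (\<Union>n. E n)"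
    proof (rule ccontr)
      assume "x \<notin> (\<Union>n. E n)"
      then have *: "\<exists>d>0. \<forall>y. \<bar>y - x\<bar> < d \<longrightarrow> \<not> bad (inverse (real (Suc n))) x y" for n
        using x by (auto simp: E_def)
      have "(G has_derivative (*) (g x)) (at x within {a..b})"
        unfolding has_derivative_within_alt
      proof (intro conjI allI impI)
        show "bounded_linear ((*) (g x))" by (rule bounded_linear_mult_right)
        fix e :: real assume "e > 0"
        then obtain n where n: "inverse (real (Suc n)) < e" using reals_Archimedean by blast
        obtain d where d: "d > 0" "\<And>y. \<bar>y - x\<bar> < d \<Longrightarrow> \<not> bad (inverse (real (Suc n))) x y" using * by blast
        have "\<bar>G y - G x - g x * (y - x)\<bar> \<le> e * \<bar>y - x\<bar>" if "y \<in> {a..b}" "\<bar>y - x\<bar> < d" for y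
        proof (cases "y = x")
          case False
          then have "\<bar>G y - G x - g x * (y - x)\<bar> \<le> inverse (real (Suc n)) * \<bar>y - x\<bar>"
            using d(2)[OF that(2)] that by (auto simp: bad_def)
          also have "\<dots> \<le> e * \<bar>y - x\<bar>" using n by (intro mult_right_mono) auto
          finally show ?thesis .
        qed auto
        then show "\<exists>d>0. \<forall>y\<in>{a..b}. norm (y - x) < d \<longrightarrow> norm (G y - G x - g x * (y - x)) \<le> e * norm (y - x)"
          using d(1) by auto
      qed
      then show False using x(2) by (simp add: has_field_derivative_def)
    qed
  qed
  moreover have "negligible (E n)" for n
    unfolding negligible_outer_le
  proof (intro allI impI)
    fix e :: real assume e: "e > 0"
    define \<eta> where "\<eta> = inverse (real (Suc n))"
    have \<eta>: "\<eta> > 0" by (simp add: \<eta>_def)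
    obtain \<gamma> where \<gamma>: "gauge \<gamma>" "\<And>p. p tagged_partial_division_of {a..b} \<Longrightarrow> \<gamma> fine p \<Longrightarrow>
         (\<Sum>(x,K)\<in>p. norm (measure lborel K *\<^sub>R g x - integral K g)) < \<eta> * e"
      using Henstock_lemma[of g a b "\<eta> * e"] g e \<eta> by auto
    define K where "K = {(x, y). x \<in> E n \<and> bad \<eta> x y \<and> {min x y..max x y} \<subseteq> \<gamma> x}"
    \<comment> \<open>Midpoint and half-length turn the interval between \<open>x\<close> and
      \<open>y\<close> into a ball for the Vitali theorem; its tag \<open>x\<close> is an
      endpoint.\<close>
    define c where "c = (\<lambda>(x::real, y). (x + y) / 2)"
    define r where "r = (\<lambda>(x::real, y). \<bar>y - x\<bar> / 2)"
    have cb: "cball (c (x, y)) (r (x, y)) = {min x y..max x y}" for x y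
      by (auto simp: c_def r_def cball_eq_atLeastAtMost min_def max_def abs_if field_simps)
    have rpos: "0 < r i" if "i \<in> K" for i
      using that by (auto simp: K_def r_def bad_def)
    have cov: "\<exists>i. i \<in> K \<and> x \<in> cball (c i) (r i) \<and> r i < d" if x: "x \<in> E n" and d: "0 < d" for x d
    proof -
      obtain d' where d': "d' > 0" "ball x d' \<subseteq> \<gamma> x"
        using \<gamma>(1) unfolding gauge_def by (meson openE)
      obtain y where y: "\<bar>y - x\<bar> < min d d'" "bad \<eta> x y"
      proof -
        have "min d d' > 0" using d d' by simp
        then show thesis using x that unfolding E_def \<eta>_def by blast
      qed
      have "{min x y..max x y} \<subseteq> ball x d'" using y by (auto simp: dist_real_def)
      then have "(x, y) \<in> K" using x y d' by (auto simp: K_def)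
      moreover have "x \<in> cball (c (x, y)) (r (x, y))" unfolding cb by auto
      moreover have "r (x, y) < d" using y by (auto simp: r_def)
      ultimately show ?thesis by blast
    qed
    obtain C where C: "countable C" "C \<subseteq> K"
      "pairwise (\<lambda>i j. disjnt (cball (c i) (r i)) (cball (c j) (r j))) C"
      "negligible (E n - (\<Union>i\<in>C. cball (c i) (r i)))"
      by (rule Vitali_covering_theorem_cballs[of K r "E n" c, OF rpos cov])
    \<comment> \<open>The Henstock lemma treats finite partial divisions only. A bound uniform over
      all finite subfamilies passes to the countable union.\<close>
    have fin: "measure lebesgue (\<Union>i\<in>C'. cball (c i) (r i)) \<le> e" if C': "C' \<subseteq> C" "finite C'" for C'
    proof -
      define w where "w i = (fst i, cball (c i) (r i))" for i :: "real \<times> real"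
      have inj: "inj_on w C'"
      proof (rule inj_onI)
        fix i j assume ij: "i \<in> C'" "j \<in> C'" "w i = w j"
        then have "cball (c i) (r i) = cball (c j) (r j)" by (simp add: w_def)
        moreover have "c i \<in> cball (c i) (r i)"
          using rpos[of i] ij C' C(2) by (auto intro: less_imp_le)
        ultimately have "\<not> disjnt (cball (c i) (r i)) (cball (c j) (r j))" by (metis disjnt_iff)
        then show "i = j" using C(3) C' ij unfolding pairwise_def by blast
      qed
      have "w ` C' tagged_partial_division_of {a..b}"
        unfolding tagged_partial_division_of_def
      proof (intro conjI allI impI)
        show "finite (w ` C')" using C' by simp
        fix x L assume "(x, L) \<in> w ` C'"
        then obtain y where "(x, y) \<in> C'" "L = {min x y..max x y}" by (auto simp: w_def cb)
        then show "x \<in> L" "L \<subseteq> {a..b}" "\<exists>a b. L = cbox a b"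
          using C' C(2) by (auto simp: K_def E_def bad_def)
      next
        fix x1 K1 x2 K2 assume "(x1, K1) \<in> w ` C' \<and> (x2, K2) \<in> w ` C' \<and> (x1, K1) \<noteq> (x2, K2)"
        then obtain i j where "i \<in> C'" "j \<in> C'" "i \<noteq> j" "K1 = cball (c i) (r i)" "K2 = cball (c j) (r j)"
          by (auto simp: w_def)
        then have "disjnt K1 K2" using C(3) C' by (auto simp: pairwise_def)
        then show "interior K1 \<inter> interior K2 = {}" using interior_subset by (fastforce simp: disjnt_def)
      qed
      moreover have "\<gamma> fine w ` C'"
      proof (rule fineI)
        fix x L assume "(x, L) \<in> w ` C'"
        then obtain y where "(x, y) \<in> C'" "L = {min x y..max x y}" by (auto simp: w_def cb)
        then show "L \<subseteq> \<gamma> x" using C' C(2) by (auto simp: K_def)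
      qed
      ultimately have "(\<Sum>(x,L)\<in>w ` C'. norm (measure lborel L *\<^sub>R g x - integral L g)) < \<eta> * e"
        by (rule \<gamma>(2))
      also have "(\<Sum>(x,L)\<in>w ` C'. norm (measure lborel L *\<^sub>R g x - integral L g))
          = (\<Sum>i\<in>C'. \<bar>measure lborel (cball (c i) (r i)) * g (fst i) - integral (cball (c i) (r i)) g\<bar>)"
        unfolding sum.reindex[OF inj] by (auto simp: w_def)
      finally have less: "(\<Sum>i\<in>C'. \<bar>measure lborel (cball (c i) (r i)) * g (fst i) - integral (cball (c i) (r i)) g\<bar>) < \<eta> * e" .
      \<comment> \<open>On every selected interval the Riemann error is at least
        \<open>\<eta>\<close> times the length. This is why the Henstock bound was requested as
        \<open>\<eta> * e\<close>: dividing by \<open>\<eta>\<close> leaves \<open>e\<close> for the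
        total length.\<close>
      have "\<eta> * measure lborel (cball (c i) (r i)) \<le> \<bar>measure lborel (cball (c i) (r i)) * g (fst i) - integral (cball (c i) (r i)) g\<bar>"
        if i: "i \<in> C'" for i
      proof -
        obtain x y where xy: "i = (x, y)" by (cases i)
        have *: "x \<in> {a..b}" "y \<in> {a..b}" "\<bar>G y - G x - g x * (y - x)\<bar> > \<eta> * \<bar>y - x\<bar>"
          using i C' C(2) xy by (auto simp: K_def E_def bad_def)
        have diff: "integral {u..v} g = G v - G u" if "u \<in> {a..b}" "v \<in> {a..b}" "u \<le> v" for u v
          using Henstock_Kurzweil_Integration.integral_combine[where a = a and c = u and b = v and f = g] that integrable_subinterval_real[OF g, of a v]
          by (auto simp: G_def)
        show ?thesis
        proof (cases "x \<le> y")
          case True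
          then show ?thesis using * diff[of x y] unfolding xy cb by (simp add: mult.commute abs_minus_commute)
        next
          case False
          then have "\<eta> * (x - y) \<le> \<bar>(x - y) * g x - (G x - G y)\<bar>"
            using * by (simp add: abs_minus_commute algebra_simps)
          then show ?thesis using False diff[of y x] * unfolding xy cb by (simp add: min_def max_def)
        qed
      qed
      then have "\<eta> * (\<Sum>i\<in>C'. measure lborel (cball (c i) (r i))) < \<eta> * e"
        unfolding sum_distrib_left by (rule le_less_trans[OF sum_mono less])
      then have "(\<Sum>i\<in>C'. measure lborel (cball (c i) (r i))) < e" using \<eta> by simp
      moreover have "measure lebesgue (\<Union>i\<in>C'. cball (c i) (r i)) \<le> (\<Sum>i\<in>C'. measure lebesgue (cball (c i) (r i)))"
        by (rule measure_UNION_le) (use C' in auto)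
      ultimately show ?thesis by simp
    qed
    have U: "(\<Union>i\<in>C. cball (c i) (r i)) \<in> lmeasurable" "measure lebesgue (\<Union>i\<in>C. cball (c i) (r i)) \<le> e"
      by (rule fmeasurable_UN_bound[OF C(1) _ fin] measure_UN_bound[OF C(1) _ fin]; simp)+
    let ?R = "E n - (\<Union>i\<in>C. cball (c i) (r i))"
    show "\<exists>T. E n \<subseteq> T \<and> T \<in> lmeasurable \<and> measure lebesgue T \<le> e"
    proof (intro exI conjI)
      show "E n \<subseteq> (\<Union>i\<in>C. cball (c i) (r i)) \<union> ?R" by auto
      show "(\<Union>i\<in>C. cball (c i) (r i)) \<union> ?R \<in> lmeasurable"
        by (rule fmeasurable.Un[OF U(1) negligible_imp_measurable[OF C(4)]])
      show "measure lebesgue ((\<Union>i\<in>C. cball (c i) (r i)) \<union> ?R) \<le> e"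
      proof -
        have "measure lebesgue ((\<Union>i\<in>C. cball (c i) (r i)) \<union> ?R)
            \<le> measure lebesgue (\<Union>i\<in>C. cball (c i) (r i)) + measure lebesgue ?R"
          by (rule measure_Un_le[OF fmeasurableD[OF U(1)] negligible_imp_sets[OF C(4)]])
        then show ?thesis using U(2) negligible_imp_measure0[OF C(4)] by linarith
      qed
    qed
  qed
  ultimately show ?thesis
    unfolding G_def using negligible_subset negligible_Union_nat by blast
qed

section \<open>Riemann--Liouville integrals of essentially bounded functions\<close>

lemma AE_lebesgue_on_iff_negligible:
  assumes "S \<in> sets lebesgue"
  shows "(AE t in lebesgue_on S. P t) \<longleftrightarrow> negligible {t\<in>S. \<not> P t}"
proof -
  have "(AE t in lebesgue_on S. P t) \<longleftrightarrow> (AE t in lebesgue. t \<in> S \<longrightarrow> P t)"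
    using assms by (subst AE_restrict_space_iff) auto
  then show ?thesis by (simp add: completion.AE_iff_null_sets negligible_iff_null_sets)
qed

text \<open>Exceptional sets are kept as negligible sets, which makes passing to subsets and unions
  immediate. On a negligible \<open>S\<close> the constant \<open>M\<close> may be negative, so
  \<open>0 \<le> M\<close> is carried as a separate assumption.\<close>

definition ess_bounded :: "real set \<Rightarrow> real \<Rightarrow> (real \<Rightarrow> real) \<Rightarrow> bool" where
  "ess_bounded S M g \<longleftrightarrow> g \<in> borel_measurable (lebesgue_on S) \<and> negligible {t\<in>S. \<not> \<bar>g t\<bar> \<le> M}"

lemma ess_bounded_subset:
  assumes "ess_bounded S M g" "T \<subseteq> S"
  shows "ess_bounded T M g"
  using assms unfolding ess_bounded_def
  by (auto intro: negligible_subset[of "{t \<in> S. \<not> \<bar>g t\<bar> \<le> M}"] measurable_restrict_mono)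

lemma ess_bounded_cong:
  assumes g: "ess_bounded S M g" and S: "S \<in> sets lebesgue" and N: "negligible {t \<in> S. h t \<noteq> g t}"
  shows "ess_bounded S M h"
  unfolding ess_bounded_def
proof
  have "g measurable_on S" using g S by (simp add: ess_bounded_def measurable_on_iff_borel_measurable)
  then have "h measurable_on S"
    by (rule measurable_on_spike[OF _ N]) auto
  then show "h \<in> borel_measurable (lebesgue_on S)" using S by (simp add: measurable_on_iff_borel_measurable)
  show "negligible {t \<in> S. \<not> \<bar>h t\<bar> \<le> M}"
  proof (rule negligible_subset)
    show "negligible ({t \<in> S. \<not> \<bar>g t\<bar> \<le> M} \<union> {t \<in> S. h t \<noteq> g t})"
      using g N by (simp add: ess_bounded_def)
  qed auto
qed

lemma ess_bounded_diff:
  assumes "ess_bounded S M g" "ess_bounded S M' h" "S \<in> sets lebesgue"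
  shows "ess_bounded S (M + M') (\<lambda>t. g t - h t)"
  unfolding ess_bounded_def
proof
  show "(\<lambda>t. g t - h t) \<in> borel_measurable (lebesgue_on S)"
    using assms unfolding ess_bounded_def by (intro borel_measurable_diff) auto
  show "negligible {t \<in> S. \<not> \<bar>g t - h t\<bar> \<le> M + M'}"
  proof (rule negligible_subset)
    show "negligible ({t \<in> S. \<not> \<bar>g t\<bar> \<le> M} \<union> {t \<in> S. \<not> \<bar>h t\<bar> \<le> M'})"
      using assms by (simp add: ess_bounded_def)
  qed auto
qed

text \<open>Fubini on products of \<open>lborel\<close> asks for Borel functions. Truncating a Borel
  representative at \<open>M\<close> changes it on a null subset of \<open>S\<close> only and makes
  the bound hold everywhere.\<close>

lemma ess_bounded_borel_rep:
  assumes g: "ess_bounded S M g" and S: "S \<in> sets lebesgue" and M: "0 \<le> M"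
  obtains h where "h \<in> borel_measurable borel" "\<And>t. \<bar>h t\<bar> \<le> M" "negligible {t\<in>S. g t \<noteq> h t}"
proof -
  have "(\<lambda>t. if t \<in> S then g t else 0) \<in> borel_measurable lebesgue"
    using g S by (simp add: ess_bounded_def borel_measurable_if)
  then obtain h where h: "h \<in> borel_measurable lborel" "AE t in lborel. (if t \<in> S then g t else 0) = h t"
    using completion_ex_borel_measurable_real by blast
  from AE_completion[OF h(2)] have N: "negligible {t. (if t \<in> S then g t else 0) \<noteq> h t}"
    by (simp add: completion.AE_iff_null_sets negligible_iff_null_sets)
  define k where "k t = max (- M) (min M (h t))" for t
  show thesis
  proof
    show "k \<in> borel_measurable borel" using h(1) unfolding k_def by measurable
    show "\<bar>k t\<bar> \<le> M" for t using M by (auto simp: k_def)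
    show "negligible {t \<in> S. g t \<noteq> k t}"
    proof (rule negligible_subset)
      show "negligible ({t \<in> S. \<not> \<bar>g t\<bar> \<le> M} \<union> {t. (if t \<in> S then g t else 0) \<noteq> h t})"
        using g N by (simp add: ess_bounded_def)
    qed (auto simp: k_def split: if_splits)
  qed
qed

lemma continuous_on_imp_ess_bounded:
  assumes "continuous_on {a..b} u"
  obtains M where "0 \<le> M" "ess_bounded {a..b} M u"
proof -
  have "bounded (u ` {a..b})" using assms by (intro compact_imp_bounded compact_continuous_image) auto
  then obtain M where M: "M > 0" "\<And>t. t \<in> {a..b} \<Longrightarrow> \<bar>u t\<bar> \<le> M" by (auto simp: bounded_pos)
  then have *: "{t\<in>{a..b}. \<not> \<bar>u t\<bar> \<le> M} = {}" by auto
  have "ess_bounded {a..b} M u"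
    using assms unfolding ess_bounded_def * by (simp add: continuous_imp_measurable_on_sets_lebesgue)
  with M(1) show thesis by (intro that[of M]) auto
qed

section \<open>The Riemann-Liouville kernel and estimates for its integrals\<close>

definition rl_kernel :: "real \<Rightarrow> real \<Rightarrow> real \<Rightarrow> real" where
  "rl_kernel \<beta> t \<tau> = 1 / Gamma \<beta> * (t - \<tau>) powr (\<beta> - 1)"

lemma rl_kernel_nonneg: "0 < \<beta> \<Longrightarrow> 0 \<le> rl_kernel \<beta> t \<tau>"
  using Gamma_real_pos[of \<beta>] by (simp add: rl_kernel_def)

text \<open>The antiderivative is continuous up to \<open>\<tau> = t\<close>, where the kernel is
  singular for \<open>\<beta> < 1\<close>. Hence the version of the fundamental theorem that
  differentiates only in the interior.\<close>

lemma rl_kernel_has_integral: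
  assumes "0 < \<beta>" "s \<le> r" "r \<le> t"
  shows "(rl_kernel \<beta> t has_integral ((t - s) powr \<beta> - (t - r) powr \<beta>) / Gamma (\<beta> + 1)) {s..r}"
proof -
  define F where "F \<tau> = - ((t - \<tau>) powr \<beta> / Gamma (\<beta> + 1))" for \<tau>
  have "Gamma \<beta> > 0" "Gamma (\<beta> + 1) > 0" using assms by (auto intro: Gamma_real_pos)
  moreover have "Gamma (\<beta> + 1) = \<beta> * Gamma \<beta>"
    by (rule Gamma_plus1) (use assms nonpos_Ints_nonpos[of \<beta>] in force)
  ultimately have G: "Gamma \<beta> \<noteq> 0" "Gamma (\<beta> + 1) \<noteq> 0" "Gamma (\<beta> + 1) = \<beta> * Gamma \<beta>" by auto
  have "(rl_kernel \<beta> t has_integral (F r - F s)) {s..r}"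
  proof (rule fundamental_theorem_of_calculus_interior)
    have "continuous_on {s..r} (\<lambda>\<tau>. (t - \<tau>) powr \<beta>)"
      using assms by (intro continuous_on_powr' continuous_intros) auto
    then show "continuous_on {s..r} F"
      unfolding F_def using G(2) by (intro continuous_on_minus continuous_on_divide continuous_on_const) auto
    fix x assume x: "x \<in> {s<..<r}"
    have "((\<lambda>\<tau>. (t - \<tau>) powr \<beta>) has_real_derivative \<beta> * (t - x) powr (\<beta> - of_nat 1) * (- 1)) (at x)"
      using x assms by (intro DERIV_fun_powr) (auto intro!: derivative_eq_intros)
    then have "(F has_real_derivative - ((\<beta> * (t - x) powr (\<beta> - of_nat 1) * (- 1)) / Gamma (\<beta> + 1))) (at x)"
      unfolding F_def by (intro DERIV_minus DERIV_cdivide)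
    then show "(F has_vector_derivative rl_kernel \<beta> t x) (at x)"
      unfolding has_real_derivative_iff_has_vector_derivative[symmetric] G(3)
      using assms G by (simp add: rl_kernel_def)
  qed fact
  then show ?thesis by (simp add: F_def diff_divide_distrib)
qed

lemma rl_kernel_absolutely_integrable:
  assumes "0 < \<beta>" "r \<le> t"
  shows "rl_kernel \<beta> t absolutely_integrable_on {s..r}"
proof (cases "s \<le> r")
  case True
  show ?thesis
    by (rule nonnegative_absolutely_integrable_1)
       (use rl_kernel_has_integral[OF assms(1) True assms(2)] rl_kernel_nonneg[OF assms(1)] in \<open>auto intro: has_integral_integrable\<close>)
qed auto

lemma rl_integrand_absolutely_integrable:
  assumes "0 < \<beta>" "r \<le> t" "ess_bounded {s..r} M g" "0 \<le> M"
  shows "(\<lambda>\<tau>. rl_kernel \<beta> t \<tau> * g \<tau>) absolutely_integrable_on {s..r}"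
proof -
  obtain h where h: "h \<in> borel_measurable borel" "\<And>t. \<bar>h t\<bar> \<le> M" "negligible {t\<in>{s..r}. g t \<noteq> h t}"
    using ess_bounded_borel_rep[OF assms(3) _ assms(4)] by auto
  have "(\<lambda>\<tau>. h \<tau> * rl_kernel \<beta> t \<tau>) absolutely_integrable_on {s..r}"
  proof (rule absolutely_integrable_bounded_measurable_product_real)
    show "h \<in> borel_measurable (lebesgue_on {s..r})"
      using h(1) by (intro measurable_restrict_space1 measurable_completion) simp
    show "bounded (h ` {s..r})" using h(2) by (auto simp: bounded_iff)
  qed (use rl_kernel_absolutely_integrable assms in auto)
  then show ?thesis
    by (rule absolutely_integrable_spike[OF _ h(3)]) auto
qed

lemma abs_integral_le_spike:
  fixes f w :: "real \<Rightarrow> real"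
  assumes "f integrable_on S" "(w has_integral W) S" "negligible N" "\<And>x. x \<in> S - N \<Longrightarrow> \<bar>f x\<bar> \<le> w x"
  shows "\<bar>integral S f\<bar> \<le> W"
proof -
  define f' where "f' x = (if x \<in> N then 0 else f x)" for x
  define w' where "w' x = (if x \<in> N then 0 else w x)" for x
  have "integral S f = integral S f'"
    by (rule integral_spike[OF assms(3)]) (simp add: f'_def)
  moreover have "f' integrable_on S"
    by (rule integrable_spike[OF assms(1,3)]) (simp add: f'_def)
  moreover have w': "(w' has_integral W) S"
    by (rule has_integral_spike[OF assms(3) _ assms(2)]) (simp add: w'_def)
  moreover have "norm (integral S f') \<le> integral S w'"
    using calculation assms(4) by (intro integral_norm_bound_integral) (auto simp: f'_def w'_def)
  ultimately show ?thesis by (simp add: integral_unique)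
qed

lemma rl_integral_raw_eq:
  assumes "0 < \<beta>" "ess_bounded {a..t} M g" "0 \<le> M"
  shows "rl_integral_raw \<beta> a g t = integral {a..t} (\<lambda>\<tau>. rl_kernel \<beta> t \<tau> * g \<tau>)"
  unfolding rl_integral_raw_def rl_kernel_def[symmetric]
  using assms set_lebesgue_integral_eq_integral(2)[OF rl_integrand_absolutely_integrable[OF assms(1) order_refl assms(2,3)]]
  by simp

lemma rl_integral_raw_cong:
  assumes "0 < \<beta>" "ess_bounded {a..t} M g" "0 \<le> M" "negligible {\<tau>\<in>{a..t}. h \<tau> \<noteq> g \<tau>}"
  shows "rl_integral_raw \<beta> a h t = rl_integral_raw \<beta> a g t"
proof -
  have "ess_bounded {a..t} M h" using ess_bounded_cong[OF assms(2) _ assms(4)] by simp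
  then have "rl_integral_raw \<beta> a h t = integral {a..t} (\<lambda>\<tau>. rl_kernel \<beta> t \<tau> * h \<tau>)"
    using assms by (simp add: rl_integral_raw_eq)
  also have "\<dots> = integral {a..t} (\<lambda>\<tau>. rl_kernel \<beta> t \<tau> * g \<tau>)"
    by (rule integral_spike[OF assms(4)]) auto
  finally show ?thesis using assms by (simp add: rl_integral_raw_eq)
qed

lemma rl_integral_raw_diff:
  assumes "0 < \<beta>" "ess_bounded {a..t} M g" "ess_bounded {a..t} M' h" "0 \<le> M" "0 \<le> M'"
  shows "rl_integral_raw \<beta> a (\<lambda>\<tau>. g \<tau> - h \<tau>) t = rl_integral_raw \<beta> a g t - rl_integral_raw \<beta> a h t"
proof -
  have "ess_bounded {a..t} (M + M') (\<lambda>\<tau>. g \<tau> - h \<tau>)" using assms by (simp add: ess_bounded_diff)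
  then have "rl_integral_raw \<beta> a (\<lambda>\<tau>. g \<tau> - h \<tau>) t = integral {a..t} (\<lambda>\<tau>. rl_kernel \<beta> t \<tau> * g \<tau> - rl_kernel \<beta> t \<tau> * h \<tau>)"
    using assms by (simp add: rl_integral_raw_eq right_diff_distrib)
  also have "\<dots> = integral {a..t} (\<lambda>\<tau>. rl_kernel \<beta> t \<tau> * g \<tau>) - integral {a..t} (\<lambda>\<tau>. rl_kernel \<beta> t \<tau> * h \<tau>)"
    using assms rl_integrand_absolutely_integrable
    by (intro Henstock_Kurzweil_Integration.integral_diff set_lebesgue_integral_eq_integral(1)) blast+
  finally show ?thesis using assms by (simp add: rl_integral_raw_eq)
qed

text \<open>Meant for differences of two integrands with a common past up to \<open>s\<close>: the
  bound then contains the length \<open>t - s\<close> and not \<open>t - a\<close>, which makes a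
  contraction on a short interval possible.\<close>

lemma abs_rl_integral_raw_le:
  assumes "0 < \<beta>" "a \<le> s" "s \<le> t" "ess_bounded {a..t} M g" "0 \<le> M"
    and zero: "negligible {\<tau>\<in>{a..s}. g \<tau> \<noteq> 0}"
  shows "\<bar>rl_integral_raw \<beta> a g t\<bar> \<le> M * (t - s) powr \<beta> / Gamma (\<beta> + 1)"
proof -
  let ?f = "\<lambda>\<tau>. rl_kernel \<beta> t \<tau> * g \<tau>"
  have int: "?f integrable_on {a..t}"
    using assms by (intro set_lebesgue_integral_eq_integral(1) rl_integrand_absolutely_integrable) auto
  have "rl_integral_raw \<beta> a g t = integral {a..s} ?f + integral {s..t} ?f"
    using assms by (simp add: rl_integral_raw_eq[OF assms(1,4,5)] Henstock_Kurzweil_Integration.integral_combine[OF assms(2,3) int])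
  also have "integral {a..s} ?f = integral {a..s} (\<lambda>_. 0)"
    by (rule integral_spike[OF zero]) auto
  finally have eq: "rl_integral_raw \<beta> a g t = integral {s..t} ?f" by simp
  show ?thesis unfolding eq
  proof (rule abs_integral_le_spike)
    show "?f integrable_on {s..t}" using int assms(2) by (auto intro: integrable_subinterval_real)
    show "((\<lambda>\<tau>. M * rl_kernel \<beta> t \<tau>) has_integral M * (t - s) powr \<beta> / Gamma (\<beta> + 1)) {s..t}"
      using has_integral_mult_right[OF rl_kernel_has_integral[OF assms(1,3) order_refl], of M] assms(1) by simp
    show "negligible {\<tau>\<in>{a..t}. \<not> \<bar>g \<tau>\<bar> \<le> M}" using assms(4) by (simp add: ess_bounded_def)
    show "\<bar>?f \<tau>\<bar> \<le> M * rl_kernel \<beta> t \<tau>" if "\<tau> \<in> {s..t} - {\<tau>\<in>{a..t}. \<not> \<bar>g \<tau>\<bar> \<le> M}" for \<tau>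
      using that assms(2) rl_kernel_nonneg[OF assms(1)] by (auto simp: abs_mult mult.commute[of M] intro!: mult_left_mono)
  qed
qed

text \<open>Each half of the factor 2 has its own source. The new piece \<open>[r, t]\<close> gives
  the first half. On \<open>[a, r]\<close> the kernel decreases when \<open>r\<close> is replaced by
  \<open>t\<close>, since \<open>\<beta> \<le> 1\<close>, so the absolute difference of the kernels
  integrates explicitly, and \<open>(r - a) powr \<beta> \<le> (t - a) powr \<beta>\<close> leaves
  the second half.\<close>

lemma rl_integral_raw_Holder:
  assumes \<beta>: "0 < \<beta>" "\<beta> \<le> 1" and t: "a \<le> r" "r \<le> t" and g: "ess_bounded {a..t} M g" "0 \<le> M"
  shows "\<bar>rl_integral_raw \<beta> a g t - rl_integral_raw \<beta> a g r\<bar> \<le> 2 * M * (t - r) powr \<beta> / Gamma (\<beta> + 1)"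
proof -
  let ?f = "\<lambda>t \<tau>. rl_kernel \<beta> t \<tau> * g \<tau>"
  let ?N = "{\<tau>\<in>{a..t}. \<not> \<bar>g \<tau>\<bar> \<le> M}"
  have N: "negligible ?N" using g by (simp add: ess_bounded_def)
  have gr: "ess_bounded {a..r} M g" using g t by (auto intro: ess_bounded_subset)
  have gt: "ess_bounded {r..t} M g" using g t by (auto intro: ess_bounded_subset)
  have int: "?f t integrable_on {a..t}" "?f r integrable_on {a..r}" "?f t integrable_on {a..r}" "?f t integrable_on {r..t}"
    using \<beta> t g gr gt by (auto intro!: set_lebesgue_integral_eq_integral(1) rl_integrand_absolutely_integrable)
  have G: "Gamma \<beta> > 0" using \<beta> by (simp add: Gamma_real_pos)
  have "rl_integral_raw \<beta> a g t - rl_integral_raw \<beta> a g r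
      = integral {r..t} (?f t) + integral {a..r} (\<lambda>\<tau>. ?f t \<tau> - ?f r \<tau>)"
    using Henstock_Kurzweil_Integration.integral_combine[OF t int(1)] int
    by (simp add: rl_integral_raw_eq[OF \<beta>(1) g] rl_integral_raw_eq[OF \<beta>(1) gr g(2)] Henstock_Kurzweil_Integration.integral_diff)
  moreover have "\<bar>integral {r..t} (?f t)\<bar> \<le> M * ((t - r) powr \<beta> / Gamma (\<beta> + 1))"
  proof (rule abs_integral_le_spike[OF int(4) _ N])
    show "((\<lambda>\<tau>. M * rl_kernel \<beta> t \<tau>) has_integral M * ((t - r) powr \<beta> / Gamma (\<beta> + 1))) {r..t}"
      using has_integral_mult_right[OF rl_kernel_has_integral[OF \<beta>(1) t(2) order_refl], of M] \<beta>(1) by simp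
    show "\<bar>?f t \<tau>\<bar> \<le> M * rl_kernel \<beta> t \<tau>" if "\<tau> \<in> {r..t} - ?N" for \<tau>
      using that t rl_kernel_nonneg[OF \<beta>(1)] by (auto simp: abs_mult mult.commute[of M] intro!: mult_left_mono)
  qed
  moreover have "\<bar>integral {a..r} (\<lambda>\<tau>. ?f t \<tau> - ?f r \<tau>)\<bar> \<le> M * ((t - r) powr \<beta> / Gamma (\<beta> + 1))"
  proof -
    have "\<bar>integral {a..r} (\<lambda>\<tau>. ?f t \<tau> - ?f r \<tau>)\<bar> \<le> M * (((r - a) powr \<beta> - (r - r) powr \<beta>) / Gamma (\<beta> + 1)
          - ((t - a) powr \<beta> - (t - r) powr \<beta>) / Gamma (\<beta> + 1))"
    proof (rule abs_integral_le_spike)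
      show "(\<lambda>\<tau>. ?f t \<tau> - ?f r \<tau>) integrable_on {a..r}" using int by (intro integrable_diff)
      show "((\<lambda>\<tau>. M * (rl_kernel \<beta> r \<tau> - rl_kernel \<beta> t \<tau>)) has_integral M * (((r - a) powr \<beta> - (r - r) powr \<beta>) / Gamma (\<beta> + 1)
          - ((t - a) powr \<beta> - (t - r) powr \<beta>) / Gamma (\<beta> + 1))) {a..r}"
        by (intro has_integral_mult_right has_integral_diff rl_kernel_has_integral \<beta> t order_refl)
      \<comment> \<open>At \<open>r\<close> the kernel \<open>rl_kernel \<beta> r\<close> takes the
        default value 0, and the comparison of the kernels can fail.\<close>
      show "negligible (insert r ?N)" using N by simp
      fix \<tau> assume "\<tau> \<in> {a..r} - insert r ?N"
      then have \<tau>: "\<tau> < r" "\<bar>g \<tau>\<bar> \<le> M" using t by auto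
      have "(t - \<tau>) powr (\<beta> - 1) \<le> (r - \<tau>) powr (\<beta> - 1)"
        using \<tau> t \<beta> by (intro powr_mono2') auto
      then have k: "rl_kernel \<beta> t \<tau> \<le> rl_kernel \<beta> r \<tau>" unfolding rl_kernel_def using G by (intro mult_left_mono) auto
      have "\<bar>?f t \<tau> - ?f r \<tau>\<bar> = (rl_kernel \<beta> r \<tau> - rl_kernel \<beta> t \<tau>) * \<bar>g \<tau>\<bar>"
        using k by (simp add: left_diff_distrib[symmetric] abs_mult)
      also have "\<dots> \<le> (rl_kernel \<beta> r \<tau> - rl_kernel \<beta> t \<tau>) * M"
        using \<tau> k by (intro mult_left_mono) auto
      finally show "\<bar>?f t \<tau> - ?f r \<tau>\<bar> \<le> M * (rl_kernel \<beta> r \<tau> - rl_kernel \<beta> t \<tau>)" by (simp add: mult.commute)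
    qed
    also have "\<dots> \<le> M * ((t - r) powr \<beta> / Gamma (\<beta> + 1))"
    proof (rule mult_left_mono[OF _ g(2)])
      have "(r - a) powr \<beta> \<le> (t - a) powr \<beta>" using t \<beta> by (intro powr_mono2) auto
      then show "((r - a) powr \<beta> - (r - r) powr \<beta>) / Gamma (\<beta> + 1) - ((t - a) powr \<beta> - (t - r) powr \<beta>) / Gamma (\<beta> + 1)
          \<le> (t - r) powr \<beta> / Gamma (\<beta> + 1)"
        using \<beta> Gamma_real_pos[of "\<beta> + 1"] by (simp add: diff_divide_distrib[symmetric] divide_right_mono)
    qed
    finally show ?thesis .
  qed
  ultimately show ?thesis by simp
qed

lemma rl_integral_raw_at_left_end: "0 < \<beta> \<Longrightarrow> rl_integral_raw \<beta> a g a = 0"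
proof -
  assume "0 < \<beta>"
  have "(\<lambda>\<tau>. rl_kernel \<beta> a \<tau> * g \<tau>) absolutely_integrable_on {a..a}"
    unfolding absolutely_integrable_on_def by (metis box_real(2) integrable_on_refl)
  from set_lebesgue_integral_eq_integral(2)[OF this] show ?thesis
    using \<open>0 < \<beta>\<close> by (simp add: rl_integral_raw_def rl_kernel_def)
qed

lemma rl_integral_raw_one:
  assumes "ess_bounded {a..t} M g" "0 \<le> M"
  shows "rl_integral_raw 1 a g t = integral {a..t} g"
proof -
  have "rl_integral_raw 1 a g t = integral {a..t} (\<lambda>\<tau>. rl_kernel 1 t \<tau> * g \<tau>)"
    using assms by (simp add: rl_integral_raw_eq)
  \<comment> \<open>Because \<open>0 powr 0\<close> is 0, the kernel of order 1 equals 1 before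
    \<open>t\<close> but 0 at \<open>t\<close>.\<close>
  also have "\<dots> = integral {a..t} g"
    by (rule integral_spike[of "{t}"]) (auto simp: rl_kernel_def)
  finally show ?thesis .
qed

lemma rl_integral_raw_continuous_on:
  assumes \<beta>: "0 < \<beta>" "\<beta> \<le> 1" and g: "ess_bounded {a..c} M g" "0 \<le> M"
  shows "continuous_on {a..c} (rl_integral_raw \<beta> a g)"
proof -
  let ?C = "2 * M / Gamma (\<beta> + 1)"
  have bound: "\<bar>rl_integral_raw \<beta> a g t - rl_integral_raw \<beta> a g r\<bar> \<le> ?C * \<bar>t - r\<bar> powr \<beta>"
    if "t \<in> {a..c}" "r \<in> {a..c}" for t r
  proof (cases "r \<le> t")
    case True
    then show ?thesis using rl_integral_raw_Holder[OF \<beta>, of a r t M g] ess_bounded_subset[OF g(1), of "{a..t}"] that g(2) by simp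
  next
    case False
    then show ?thesis using rl_integral_raw_Holder[OF \<beta>, of a t r M g] ess_bounded_subset[OF g(1), of "{a..r}"] that g(2)
      by (simp add: abs_minus_commute)
  qed
  show ?thesis unfolding continuous_on_def
  proof
    fix r assume r: "r \<in> {a..c}"
    have "((\<lambda>t. ?C * \<bar>t - r\<bar> powr \<beta>) \<longlongrightarrow> ?C * \<bar>r - r\<bar> powr \<beta>) (at r within {a..c})"
      using \<beta> by (intro tendsto_intros tendsto_powr') auto
    then have "((\<lambda>t. ?C * \<bar>t - r\<bar> powr \<beta>) \<longlongrightarrow> 0) (at r within {a..c})" using \<beta> by simp
    then have "((\<lambda>t. rl_integral_raw \<beta> a g t - rl_integral_raw \<beta> a g r) \<longlongrightarrow> 0) (at r within {a..c})"
      by (rule Lim_null_comparison[rotated]) (use bound r in \<open>auto simp: eventually_at_topological\<close>)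
    then show "(rl_integral_raw \<beta> a g \<longlongrightarrow> rl_integral_raw \<beta> a g r) (at r within {a..c})"
      by (simp add: LIM_zero_iff)
  qed
qed

section \<open>Integrals of complementary orders compose to the ordinary integral\<close>

lemma rl_kernel_self [simp]: "rl_kernel \<beta> t t = 0"
  by (simp add: rl_kernel_def)

text \<open>The kernels of orders \<open>\<beta>\<close> and \<open>1 - \<beta>\<close> compose to
  the kernel of order 1. The substitution \<open>u = (x - s) / (t - s)\<close> gives the Beta
  integral \<open>Gamma (1 - \<beta>) * Gamma \<beta>\<close>, the denominator being
  \<open>Gamma 1 = 1\<close>; the powers of \<open>d = t - s\<close> combine to \<open>1 / d\<close>
  and cancel against the change of variable.\<close>

lemma rl_kernel_Beta:
  assumes "0 < \<beta>" "\<beta> < 1" "s < t"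
  shows "((\<lambda>x. rl_kernel \<beta> t x * rl_kernel (1 - \<beta>) x s) has_integral 1) {s..t}"
proof -
  define d where "d = t - s"
  have d: "d > 0" using assms by (simp add: d_def)
  let ?f = "\<lambda>u. u powr (1 - \<beta> - 1) * (1 - u) powr (\<beta> - 1)"
  let ?C = "1 / (d * (Gamma (1 - \<beta>) * Gamma \<beta>))"
  have "Gamma (1 - \<beta>) > 0" "Gamma \<beta> > 0" using assms by (auto intro!: Gamma_real_pos)
  then have G: "Gamma (1 - \<beta>) \<noteq> 0" "Gamma \<beta> \<noteq> 0" by auto
  have B: "Beta (1 - \<beta>) \<beta> = Gamma (1 - \<beta>) * Gamma \<beta>" by (simp add: Beta_def)
  have box: "(0 - (- s / d)) /\<^sub>R (1 / d) = s" "(1 - (- s / d)) /\<^sub>R (1 / d) = t"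
    using d by (auto simp: d_def divide_simps)
  have "(?f has_integral Beta (1 - \<beta>) \<beta>) (cbox 0 1)"
    using has_integral_Beta_real[of "1 - \<beta>" \<beta>] assms by simp
  from has_integral_affinity'[OF this, of "1 / d" "- s / d", unfolded box]
  have "((\<lambda>x. ?f (1 / d * x + - s / d)) has_integral d * Beta (1 - \<beta>) \<beta>) {s..t}"
    using d by simp
  then have i: "((\<lambda>x. ?C * ?f (1 / d * x + - s / d)) has_integral ?C * (d * Beta (1 - \<beta>) \<beta>)) {s..t}"
    by (rule has_integral_mult_right)
  have ii: "?C * (d * Beta (1 - \<beta>) \<beta>) = 1" using G B d by simp
  have iii: "?C * ?f (1 / d * x + - s / d) = rl_kernel \<beta> t x * rl_kernel (1 - \<beta>) x s" if "x \<in> {s..t}" for x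
  proof -
    have *: "1 / d * x + - s / d = (x - s) / d" "1 - (x - s) / d = (t - x) / d"
      using d by (simp_all add: field_simps) (simp add: d_def)
    have "d powr (- \<beta>) * d powr (\<beta> - 1) = d powr (- 1)"
      unfolding powr_add[symmetric] by simp
    then have "d powr (- \<beta>) * d powr (\<beta> - 1) = 1 / d"
      using d by (simp only: powr_neg_one)
    moreover have "((x - s) / d) powr (- \<beta>) * ((t - x) / d) powr (\<beta> - 1)
        = (x - s) powr (- \<beta>) * (t - x) powr (\<beta> - 1) / (d powr (- \<beta>) * d powr (\<beta> - 1))"
      using that d by (simp add: powr_divide)
    ultimately have "?f ((x - s) / d) = (x - s) powr (- \<beta>) * (t - x) powr (\<beta> - 1) * d"
      unfolding *(2) using d by simp
    then show ?thesis unfolding * using d G by (simp add: rl_kernel_def mult.commute)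
  qed
  show ?thesis using has_integral_eq[OF iii i] unfolding ii .
qed

lemma rl_integral_raw_lborel:
  assumes "\<beta> \<noteq> 0" and [measurable]: "g \<in> borel_measurable borel"
  shows "rl_integral_raw \<beta> a g t = (\<integral>\<tau>. indicator {a..t} \<tau> * (rl_kernel \<beta> t \<tau> * g \<tau>) \<partial>lborel)"
proof -
  have "(\<lambda>\<tau>. indicator {a..t} \<tau> * (rl_kernel \<beta> t \<tau> * g \<tau>)) \<in> borel_measurable lborel"
    unfolding rl_kernel_def by measurable
  from integral_completion[OF this] show ?thesis
    using assms(1) by (simp add: rl_integral_raw_def set_lebesgue_integral_def rl_kernel_def)
qed

lemma rl_integral_raw_borel_measurable:
  assumes "\<beta> \<noteq> 0" and [measurable]: "g \<in> borel_measurable borel"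
  shows "rl_integral_raw \<beta> a g \<in> borel_measurable borel"
proof -
  have "rl_integral_raw \<beta> a g = (\<lambda>t. \<integral>\<tau>. (if a \<le> \<tau> \<and> \<tau> \<le> t then rl_kernel \<beta> t \<tau> * g \<tau> else 0) \<partial>lborel)"
    unfolding rl_integral_raw_lborel[OF assms]
    by (intro ext Bochner_Integration.integral_cong) (auto simp: indicator_def)
  then show ?thesis unfolding rl_kernel_def by simp measurable
qed

lemma integrable_bounded_Icc:
  fixes g :: "real \<Rightarrow> real"
  assumes "g \<in> borel_measurable borel" "\<And>t. \<bar>g t\<bar> \<le> M"
  shows "integrable lborel (\<lambda>x. indicator {a..t} x * g x)"
  using integrableI_bounded_set_indicator[of "{a..t}" lborel g M] assms
  by (auto simp: emeasure_lborel_Icc_eq)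

text \<open>Fubini on the triangle \<open>a \<le> \<tau> \<le> s \<le> t\<close>: integrating first
  in \<open>s\<close> leaves the factor 1 of \<open>rl_kernel_Beta\<close> in front of
  \<open>g \<tau>\<close>.\<close>

lemma rl_integral_raw_compose_borel:
  assumes \<beta>: "0 < \<beta>" "\<beta> < 1" and [measurable]: "g \<in> borel_measurable borel" and M: "\<And>t. \<bar>g t\<bar> \<le> M"
  shows "rl_integral_raw \<beta> a (rl_integral_raw (1 - \<beta>) a g) t = (\<integral>\<tau>. indicator {a..t} \<tau> * g \<tau> \<partial>lborel)"
proof -
  define k where "k \<tau> s = indicator {\<tau>..t} s * (rl_kernel \<beta> t s * rl_kernel (1 - \<beta>) s \<tau>)" for \<tau> s :: real
  define f where "f \<tau> s = indicator {a..t} \<tau> * g \<tau> * k \<tau> s" for \<tau> s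
  have [measurable]: "(\<lambda>(\<tau>, s). f \<tau> s) \<in> borel_measurable (lborel \<Otimes>\<^sub>M lborel)"
  proof -
    have "(\<lambda>(\<tau>, s). f \<tau> s) = (\<lambda>(\<tau>, s). indicator {a..t} \<tau> * g \<tau> *
        (if \<tau> \<le> s \<and> s \<le> t then rl_kernel \<beta> t s * rl_kernel (1 - \<beta>) s \<tau> else 0))"
      by (auto simp: f_def k_def indicator_def)
    then show ?thesis unfolding rl_kernel_def by simp measurable
  qed
  have k: "has_bochner_integral lborel (k \<tau>) 1" if "\<tau> < t" for \<tau>
  proof (rule has_bochner_integral_nn_integral)
    show meas: "k \<tau> \<in> borel_measurable lborel" unfolding k_def rl_kernel_def by measurable
    have nn: "0 \<le> k \<tau> s" for s using \<beta> by (simp add: k_def rl_kernel_nonneg)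
    then show "AE s in lborel. 0 \<le> k \<tau> s" by simp
    have "((\<lambda>s. if s \<in> {\<tau>..t} then rl_kernel \<beta> t s * rl_kernel (1 - \<beta>) s \<tau> else 0) has_integral 1) UNIV"
      using rl_kernel_Beta[OF \<beta> that] by (simp only: has_integral_restrict_UNIV)
    moreover have "(\<lambda>s. if s \<in> {\<tau>..t} then rl_kernel \<beta> t s * rl_kernel (1 - \<beta>) s \<tau> else 0) = k \<tau>"
      by (auto simp: k_def indicator_def)
    ultimately have "(k \<tau> has_integral 1) UNIV" by simp
    then show "(\<integral>\<^sup>+ s. ennreal (k \<tau> s) \<partial>lborel) = ennreal 1"
      using meas nn by (intro nn_integral_has_integral_lborel) auto
  qed simp
  \<comment> \<open>Here the range of \<open>s\<close> is empty or the single point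
    \<open>t\<close>, where the kernel vanishes by \<open>rl_kernel_self\<close>.\<close>
  have f0: "f \<tau> s = 0" if "\<not> \<tau> < t" for \<tau> s
  proof (cases "\<tau> \<le> s \<and> s \<le> t")
    case True
    then have "s = t" using that by simp
    then show ?thesis by (simp add: f_def k_def)
  qed (auto simp: f_def k_def)
  have intf: "integrable lborel (f \<tau>)" for \<tau>
  proof (cases "\<tau> < t")
    case True
    then show ?thesis using k[OF True] by (simp add: f_def[abs_def] has_bochner_integral_iff)
  next
    case False
    then have "f \<tau> = (\<lambda>_. 0)" using f0 by blast
    then show ?thesis by simp
  qed
  \<comment> \<open>The product of the kernels is nonnegative with mass 1, so the absolute inner
    integral is at most \<open>\<bar>g \<tau>\<bar>\<close>. Boundedness of \<open>g\<close> then
    yields integrability on the product.\<close>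
  have absf: "(\<integral>s. \<bar>f \<tau> s\<bar> \<partial>lborel) = indicator {a..t} \<tau> * \<bar>g \<tau>\<bar> * (if \<tau> < t then 1 else 0)" for \<tau>
  proof (cases "\<tau> < t")
    case True
    have "\<bar>f \<tau> s\<bar> = indicator {a..t} \<tau> * \<bar>g \<tau>\<bar> * k \<tau> s" for s
      using \<beta> by (simp add: f_def abs_mult k_def rl_kernel_nonneg)
    then show ?thesis using True k[OF True] by (simp add: has_bochner_integral_iff)
  qed (simp add: f0)
  have prod: "integrable (lborel \<Otimes>\<^sub>M lborel) (\<lambda>(\<tau>, s). f \<tau> s)"
  proof (rule lborel_pair.Fubini_integrable)
    have "integrable lborel (\<lambda>\<tau>. indicator {a..t} \<tau> * (\<bar>g \<tau>\<bar> * (if \<tau> < t then 1 else 0)))"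
      by (rule integrable_bounded_Icc[of _ M]) (use M in \<open>auto intro: order_trans[OF abs_ge_zero]\<close>)
    then show "integrable lborel (\<lambda>\<tau>. \<integral>s. norm (case (\<tau>, s) of (\<tau>, s) \<Rightarrow> f \<tau> s) \<partial>lborel)"
      by (simp add: absf mult.assoc)
  qed (use intf in auto)
  have "(\<integral>s. (\<integral>\<tau>. f \<tau> s \<partial>lborel) \<partial>lborel) = (\<integral>\<tau>. (\<integral>s. f \<tau> s \<partial>lborel) \<partial>lborel)"
    by (rule lborel_pair.Fubini_integral[OF prod])
  moreover have "(\<integral>\<tau>. f \<tau> s \<partial>lborel) = indicator {a..t} s * (rl_kernel \<beta> t s * rl_integral_raw (1 - \<beta>) a g s)" for s
  proof -
    have "f \<tau> s = indicator {a..t} s * rl_kernel \<beta> t s * (indicator {a..s} \<tau> * (rl_kernel (1 - \<beta>) s \<tau> * g \<tau>))" for \<tau>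
      by (auto simp: f_def k_def indicator_def)
    then show ?thesis using \<beta> by (simp add: rl_integral_raw_lborel)
  qed
  moreover have "(\<integral>\<tau>. (\<integral>s. f \<tau> s \<partial>lborel) \<partial>lborel) = (\<integral>\<tau>. indicator {a..t} \<tau> * g \<tau> \<partial>lborel)"
  proof (rule integral_cong_AE)
    show "AE \<tau> in lborel. (\<integral>s. f \<tau> s \<partial>lborel) = indicator {a..t} \<tau> * g \<tau>"
      using AE_lborel_singleton[of t]
    proof eventually_elim
      case (elim \<tau>)
      show ?case
      proof (cases "\<tau> < t")
        case True
        then show ?thesis using k[OF True] by (simp add: f_def has_bochner_integral_iff)
      qed (use elim f0 in \<open>auto simp: indicator_def\<close>)
    qed
  qed measurable
  ultimately show ?thesis
    using \<beta> rl_integral_raw_lborel[of \<beta> "rl_integral_raw (1 - \<beta>) a g" a t] rl_integral_raw_borel_measurable[of "1 - \<beta>" g a]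
    by simp
qed

lemma rl_integral_raw_eqI:
  assumes "\<beta> \<noteq> 0" "\<And>\<tau>. \<tau> \<in> {a..t} \<Longrightarrow> g \<tau> = h \<tau>"
  shows "rl_integral_raw \<beta> a g t = rl_integral_raw \<beta> a h t"
  using assms unfolding rl_integral_raw_def by (auto intro!: set_lebesgue_integral_cong)

lemma rl_integral_raw_compose:
  assumes \<beta>: "0 < \<beta>" "\<beta> < 1" and g: "ess_bounded {a..t} M g" "0 \<le> M"
  shows "rl_integral_raw \<beta> a (rl_integral_raw (1 - \<beta>) a g) t = integral {a..t} g"
proof -
  obtain h where h: "h \<in> borel_measurable borel" "\<And>t. \<bar>h t\<bar> \<le> M" "negligible {\<tau>\<in>{a..t}. g \<tau> \<noteq> h \<tau>}"
    using ess_bounded_borel_rep[OF g(1) _ g(2)] by auto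
  have "rl_integral_raw (1 - \<beta>) a h s = rl_integral_raw (1 - \<beta>) a g s" if "s \<in> {a..t}" for s
  proof (rule rl_integral_raw_cong)
    show "ess_bounded {a..s} M g" using g that by (auto intro: ess_bounded_subset)
    show "negligible {\<tau> \<in> {a..s}. h \<tau> \<noteq> g \<tau>}"
      by (rule negligible_subset[OF h(3)]) (use that in auto)
  qed (use \<beta> g in auto)
  then have "rl_integral_raw \<beta> a (rl_integral_raw (1 - \<beta>) a g) t = rl_integral_raw \<beta> a (rl_integral_raw (1 - \<beta>) a h) t"
    using \<beta> by (intro rl_integral_raw_eqI[where g = "rl_integral_raw (1 - \<beta>) a g"]) auto
  also have "\<dots> = (\<integral>\<tau>. indicator {a..t} \<tau> * h \<tau> \<partial>lborel)"
    by (rule rl_integral_raw_compose_borel[OF \<beta> h(1,2)])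
  also have "\<dots> = integral {a..t} h"
    using set_borel_integral_eq_integral(2)[of "{a..t}" h] integrable_bounded_Icc[OF h(1,2)]
    by (simp add: set_integrable_def set_lebesgue_integral_def)
  also have "\<dots> = integral {a..t} g"
    by (rule integral_spike[OF h(3)]) auto
  finally show ?thesis .
qed

section \<open>Time intervals and the continuous representative\<close>

lemma intervals_fromD:
  assumes "I \<in> intervals_from a"
  shows "a \<in> I" "is_interval I" "t \<in> I \<Longrightarrow> a \<le> t" "t \<in> I \<Longrightarrow> {a..t} \<subseteq> I" "\<exists>t\<in>I. a < t" "I \<in> sets lebesgue"
proof -
  show "a \<in> I" and i: "is_interval I" and ge: "t \<in> I \<Longrightarrow> a \<le> t" for t using assms by (auto simp: intervals_from_def)
  show "{a..t} \<subseteq> I" if "t \<in> I"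
    using mem_is_interval_1_I[OF i \<open>a \<in> I\<close> that] by auto
  obtain t where "t \<in> I" "t \<noteq> a" using assms by (auto simp: intervals_from_def)
  then show "\<exists>t\<in>I. a < t" using ge[of t] by (intro bexI[of _ t]) auto
  show "I \<in> sets lebesgue" using real_interval_borel_measurable[OF i] by simp
qed

text \<open>Transfers results on compact intervals to \<open>I\<close>, which may be half-open or
  unbounded. Countability of \<open>D\<close> keeps the union of the exceptional sets null, and the
  equality of filters lets derivatives within \<open>I\<close> be taken within
  \<open>{a..c}\<close>. If \<open>I\<close> has a last point, that point alone serves; otherwise
  its rational points do.\<close>

lemma intervals_from_exhaustion:
  assumes I: "I \<in> intervals_from a"
  obtains D where "countable D" "D \<subseteq> I" "\<And>t. t \<in> I \<Longrightarrow> \<exists>c\<in>D. a < c \<and> t \<le> c \<and> at t within I = at t within {a..c}"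
proof (cases "\<exists>m\<in>I. \<forall>t\<in>I. t \<le> m")
  case True
  then obtain m where m: "m \<in> I" "\<And>t. t \<in> I \<Longrightarrow> t \<le> m" by blast
  then have "I = {a..m}" using intervals_fromD(4)[OF I m(1)] intervals_fromD(3)[OF I] by (intro equalityI subsetI) auto
  moreover have "a < m" using intervals_fromD(5)[OF I] m(2) by force
  ultimately show thesis using m(1) by (intro that[of "{m}"]) simp_all
next
  case False
  show thesis
  proof (rule that[of "I \<inter> \<rat>"])
    show "countable (I \<inter> \<rat>)" by (simp add: countable_rat)
    fix t assume t: "t \<in> I"
    then obtain c' where c': "c' \<in> I" "t < c'" using False by (meson not_le)
    obtain c where c: "c \<in> \<rat>" "t < c" "c < c'" using Rats_dense_in_real[OF c'(2)] by blast
    then have cI: "c \<in> I" using intervals_fromD(2)[OF I] t c' unfolding is_interval_1 by (meson less_imp_le)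
    have "at t within I = at t within {a..c}"
      by (rule at_within_nhd[of t "{..<c}"]) (use c cI intervals_fromD(3,4)[OF I] in fastforce)+
    moreover have "a < c" using intervals_fromD(3)[OF I t] c by simp
    ultimately show "\<exists>c\<in>I \<inter> \<rat>. a < c \<and> t \<le> c \<and> at t within I = at t within {a..c}"
      using c cI by force
  qed auto
qed

lemma continuous_on_intervals_from:
  assumes I: "I \<in> intervals_from a" and "\<And>c. c \<in> I \<Longrightarrow> continuous_on {a..c} h"
  shows "continuous_on I h"
  unfolding continuous_on_def
proof
  fix t assume t: "t \<in> I"
  obtain D where "D \<subseteq> I" "\<exists>c\<in>D. a < c \<and> t \<le> c \<and> at t within I = at t within {a..c}"
    using intervals_from_exhaustion[OF I] t by metis
  then obtain c where "c \<in> I" "t \<le> c" "at t within I = at t within {a..c}" by blast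
  then show "(h \<longlongrightarrow> h t) (at t within I)"
    using assms(2)[of c] intervals_fromD(3)[OF I t] by (simp add: continuous_on_def)
qed

lemma continuous_on_AE_eq:
  fixes g h :: "real \<Rightarrow> real"
  assumes I: "I \<in> intervals_from a" and g: "continuous_on I g" and h: "continuous_on I h"
    and N: "negligible {t\<in>I. g t \<noteq> h t}" and t: "t \<in> I"
  shows "g t = h t"
proof (rule ccontr)
  assume ne: "g t \<noteq> h t"
  have "continuous_on I (\<lambda>s. g s - h s)" using g h by (intro continuous_intros)
  then obtain d where d: "d > 0" "\<And>s. s \<in> I \<Longrightarrow> dist s t < d \<Longrightarrow> dist (g s - h s) (g t - h t) < \<bar>g t - h t\<bar>"
    using ne t unfolding continuous_on_iff by (metis eq_iff_diff_eq_0 zero_less_abs_iff)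
  have ne': "g s \<noteq> h s" if "s \<in> I" "\<bar>s - t\<bar> < d" for s
    using d(2)[OF that(1)] that(2) by (auto simp: dist_real_def)
  obtain p where p: "p \<in> I" "p \<noteq> t" using intervals_fromD(1,5)[OF I] by (metis less_irrefl)
  \<comment> \<open>As \<open>t\<close> may be an endpoint of \<open>I\<close>, the short interval
    on which \<open>g\<close> and \<open>h\<close> differ is taken on the side of \<open>t\<close>
    where another point \<open>p\<close> of \<open>I\<close> lies.\<close>
  define l u where "l = (if p < t then max p (t - d) else t)" "u = (if p < t then t else min p (t + d))"
  have "{l<..<u} \<subseteq> {t\<in>I. g t \<noteq> h t}"
  proof
    fix s assume s: "s \<in> {l<..<u}"
    have "min p t \<le> s" "s \<le> max p t" using s by (auto simp: l_u_def split: if_splits)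
    from this have "s \<in> I" using mem_is_interval_1_I[OF intervals_fromD(2)[OF I], of "min p t" "max p t" s] t p
      by (auto simp: min_def max_def split: if_splits)
    moreover have "\<bar>s - t\<bar> < d" using s by (auto simp: l_u_def split: if_splits)
    ultimately show "s \<in> {t\<in>I. g t \<noteq> h t}" using ne' by auto
  qed
  then have "negligible (box l u)" using N negligible_subset by auto
  moreover have "l < u" using p d(1) by (auto simp: l_u_def)
  ultimately show False using negligible_interval(2)[of l u] by simp
qed

text \<open>Eliminates the choice in \<open>rl_integral\<close>: the selected representative and
  \<open>h\<close> are continuous and agree almost everywhere, hence at every point of
  \<open>I\<close>.\<close>

lemma rl_integral_eq_raw:
  assumes I: "I \<in> intervals_from a" and c: "continuous_on I h" "\<And>t. t \<in> I \<Longrightarrow> rl_integral_raw \<beta> a u t = h t" and t: "t \<in> I"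
  shows "rl_integral \<beta> a I u t = h t"
proof -
  define is_rep where "is_rep g \<longleftrightarrow> continuous_on I g \<and> (AE t in lebesgue_on I. g t = rl_integral_raw \<beta> a u t)" for g
  have "AE t in lebesgue_on I. h t = rl_integral_raw \<beta> a u t"
    using c(2) by (intro AE_I2) auto
  then have "is_rep h" using c(1) by (simp add: is_rep_def)
  then have ex: "\<exists>g. is_rep g" by blast
  then have eq: "rl_integral \<beta> a I u = (SOME g. is_rep g)"
    by (simp add: rl_integral_def is_rep_def[abs_def])
  have rep: "is_rep (rl_integral \<beta> a I u)" unfolding eq using someI_ex[OF ex] .
  then have "negligible {t\<in>I. rl_integral \<beta> a I u t \<noteq> rl_integral_raw \<beta> a u t}"
    using intervals_fromD(6)[OF I] by (simp add: is_rep_def AE_lebesgue_on_iff_negligible)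
  moreover have "{t\<in>I. rl_integral \<beta> a I u t \<noteq> rl_integral_raw \<beta> a u t} = {t\<in>I. rl_integral \<beta> a I u t \<noteq> h t}"
    using c(2) by auto
  ultimately have "negligible {t\<in>I. rl_integral \<beta> a I u t \<noteq> h t}" by simp
  then show ?thesis
    using continuous_on_AE_eq[OF I _ c(1) _ t] rep by (simp add: is_rep_def)
qed

section \<open>The scalar equation as a Volterra equation\<close>

text \<open>This is the class of locally essentially bounded functions. The bound may depend on
  \<open>c\<close>, since a solution on a half-open interval need not stay in a compact set near its
  end.\<close>

definition loc_ess_bounded :: "real \<Rightarrow> real set \<Rightarrow> (real \<Rightarrow> real) \<Rightarrow> bool" where
  "loc_ess_bounded a I g \<longleftrightarrow> (\<forall>c\<in>I. \<exists>M\<ge>0. ess_bounded {a..c} M g)"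

lemma loc_ess_boundedE:
  assumes "loc_ess_bounded a I g" "c \<in> I"
  obtains M where "0 \<le> M" "ess_bounded {a..c} M g"
  using assms unfolding loc_ess_bounded_def by blast

lemma ess_bounded_integrable:
  assumes "ess_bounded {a..t} M g" "0 \<le> M"
  shows "g integrable_on {a..t}"
proof -
  have "(\<lambda>\<tau>. rl_kernel 1 t \<tau> * g \<tau>) integrable_on {a..t}"
    using assms by (intro set_lebesgue_integral_eq_integral(1) rl_integrand_absolutely_integrable) auto
  then show ?thesis
    by (rule integrable_spike[of _ _ "{t}"]) (auto simp: rl_kernel_def)
qed

lemma abs_integral_le_ess_bound:
  fixes g :: "real \<Rightarrow> real"
  assumes "ess_bounded {u..v} M g" "0 \<le> M" "u \<le> v"
  shows "\<bar>integral {u..v} g\<bar> \<le> M * (v - u)"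
proof (rule abs_integral_le_spike)
  show "g integrable_on {u..v}" using assms by (simp add: ess_bounded_integrable)
  show "((\<lambda>_. M) has_integral M * (v - u)) {u..v}"
    using has_integral_const_real[of M u v] assms(3) by (simp add: mult.commute)
  show "negligible {t\<in>{u..v}. \<not> \<bar>g t\<bar> \<le> M}" using assms by (simp add: ess_bounded_def)
qed auto

lemma continuous_on_imp_loc_ess_bounded:
  assumes I: "I \<in> intervals_from a" and u: "continuous_on I u"
  shows "loc_ess_bounded a I u"
  unfolding loc_ess_bounded_def
proof
  fix c assume "c \<in> I"
  then have "continuous_on {a..c} u" using u intervals_fromD(4)[OF I] continuous_on_subset by blast
  then obtain M where "0 \<le> M" "ess_bounded {a..c} M u" by (rule continuous_on_imp_ess_bounded)
  then show "\<exists>M\<ge>0. ess_bounded {a..c} M u" by blast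
qed

lemma rl_integral_raw_continuous_on_interval:
  assumes I: "I \<in> intervals_from a" and \<beta>: "0 < \<beta>" "\<beta> \<le> 1" and g: "loc_ess_bounded a I g"
  shows "continuous_on I (rl_integral_raw \<beta> a g)"
proof (rule continuous_on_intervals_from[OF I])
  fix c assume "c \<in> I"
  then obtain M where "0 \<le> M" "ess_bounded {a..c} M g" by (rule loc_ess_boundedE[OF g])
  then show "continuous_on {a..c} (rl_integral_raw \<beta> a g)" using \<beta> by (intro rl_integral_raw_continuous_on)
qed

text \<open>Local boundedness of \<open>g\<close> makes the primitive locally Lipschitz. The
  constant \<open>M + 1\<close> is positive even if \<open>M = 0\<close>, so
  \<open>\<epsilon> / (M + 1)\<close> is a valid choice of \<open>\<delta>\<close>.\<close>

lemma integral_AC_loc: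
  assumes I: "I \<in> intervals_from a" and g: "loc_ess_bounded a I g"
    and R: "\<And>t. t \<in> I \<Longrightarrow> R t = integral {a..t} g"
  shows "R \<in> AC_loc I"
  unfolding AC_loc_def
proof (intro CollectI allI impI)
  fix c d :: real assume cd: "{c..d} \<subseteq> I"
  show "abs_cont_on c d R"
  proof (cases "c \<le> d")
    case True
    then have dI: "d \<in> I" "a \<le> c" using cd intervals_fromD(3)[OF I] by auto
    obtain M where M: "0 \<le> M" "ess_bounded {a..d} M g" by (rule loc_ess_boundedE[OF g dI(1)])
    have Lip: "\<bar>R v - R u\<bar> \<le> (M + 1) * (v - u)" if "c \<le> u" "u \<le> v" "v \<le> d" for u v
    proof -
      have "integral {a..u} g + integral {u..v} g = integral {a..v} g"
      proof (intro Henstock_Kurzweil_Integration.integral_combine)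
        have "ess_bounded {a..v} M g" by (rule ess_bounded_subset[OF M(2)]) (use that in auto)
        then show "g integrable_on {a..v}" using M(1) by (rule ess_bounded_integrable)
      qed (use that dI in auto)
      then have "R v - R u = integral {u..v} g" using that dI cd R by (simp add: subset_eq)
      also have "\<bar>\<dots>\<bar> \<le> M * (v - u)"
        using that dI M by (intro abs_integral_le_ess_bound ess_bounded_subset[OF M(2)]) auto
      also have "\<dots> \<le> (M + 1) * (v - u)" using that by (intro mult_right_mono) auto
      finally show ?thesis .
    qed
    show ?thesis unfolding abs_cont_on_def
    proof (intro allI impI)
      fix \<epsilon> :: real assume e: "\<epsilon> > 0"
      show "\<exists>\<delta>>0. \<forall>D. finite D \<and> (\<forall>(u, v)\<in>D. c \<le> u \<and> u \<le> v \<and> v \<le> d) \<and>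
          pairwise (\<lambda>(u, v) (u', v'). {u<..<v} \<inter> {u'<..<v'} = {}) D \<and> (\<Sum>(u, v)\<in>D. v - u) < \<delta> \<longrightarrow>
          (\<Sum>(u, v)\<in>D. \<bar>R v - R u\<bar>) < \<epsilon>"
      proof (intro exI[of _ "\<epsilon> / (M + 1)"] conjI allI impI)
        show "\<epsilon> / (M + 1) > 0" using e M by simp
        fix D :: "(real \<times> real) set"
        assume D: "finite D \<and> (\<forall>(u, v)\<in>D. c \<le> u \<and> u \<le> v \<and> v \<le> d) \<and>
          pairwise (\<lambda>(u, v) (u', v'). {u<..<v} \<inter> {u'<..<v'} = {}) D \<and> (\<Sum>(u, v)\<in>D. v - u) < \<epsilon> / (M + 1)"
        have "(\<Sum>(u, v)\<in>D. \<bar>R v - R u\<bar>) \<le> (\<Sum>(u, v)\<in>D. (M + 1) * (v - u))"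
          using D Lip by (intro sum_mono) auto
        also have "\<dots> = (M + 1) * (\<Sum>(u, v)\<in>D. v - u)"
          by (simp add: sum_distrib_left split_def)
        also have "\<dots> < \<epsilon>" using D M by (simp add: field_simps)
        finally show "(\<Sum>(u, v)\<in>D. \<bar>R v - R u\<bar>) < \<epsilon>" .
      qed
    qed
  next
    case False
    then have "(\<forall>(u, v)\<in>D. c \<le> u \<and> u \<le> v \<and> v \<le> d) \<Longrightarrow> D = {}" for D :: "(real \<times> real) set"
      by fastforce
    then show ?thesis unfolding abs_cont_on_def by (metis (no_types, lifting) sum.empty zero_less_one)
  qed
qed

lemma continuous_on_imp_L1_loc: "continuous_on I u \<Longrightarrow> u \<in> L1_loc I"
  unfolding L1_loc_def
  by (auto intro!: absolutely_integrable_continuous_real intro: continuous_on_subset)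

lemma rl_integral_raw_compose_loc:
  assumes I: "I \<in> intervals_from a" and \<alpha>: "0 < \<alpha>" "\<alpha> \<le> 1" and g: "loc_ess_bounded a I g"
    and u: "\<And>t. t \<in> I \<Longrightarrow> u t = rl_integral_raw \<alpha> a g t" and t: "t \<in> I"
  shows "rl_integral_raw (1 - \<alpha>) a u t = integral {a..t} g"
proof -
  obtain M where M: "0 \<le> M" "ess_bounded {a..t} M g" by (rule loc_ess_boundedE[OF g t])
  show ?thesis
  \<comment> \<open>Order \<open>1 - \<alpha> = 0\<close> is the identity by definition and not a
    kernel integral, so the composition rule does not cover it.\<close>
  proof (cases "\<alpha> = 1")
    case True
    have "rl_integral_raw (1 - \<alpha>) a u t = u t" using True by (simp add: rl_integral_raw_def)
    then show ?thesis using True u[OF t] rl_integral_raw_one[OF M(2,1)] by simp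
  next
    case False
    then have "rl_integral_raw (1 - \<alpha>) a u t = rl_integral_raw (1 - \<alpha>) a (rl_integral_raw (1 - (1 - \<alpha>)) a g) t"
      using u t intervals_fromD(4)[OF I t] by (intro rl_integral_raw_eqI) auto
    also have "\<dots> = integral {a..t} g"
      using False \<alpha> by (intro rl_integral_raw_compose[OF _ _ M(2,1)]) auto
    finally show ?thesis .
  qed
qed

text \<open>Fractional differentiation undoes fractional integration: the integral of order
  \<open>1 - \<alpha>\<close> of \<open>u\<close> is the ordinary primitive of \<open>g\<close>,
  which is locally absolutely continuous and has derivative \<open>g\<close> almost
  everywhere.\<close>

lemma rl_derivative_of_rl_integral:
  assumes I: "I \<in> intervals_from a" and \<alpha>: "0 < \<alpha>" "\<alpha> \<le> 1" and g: "loc_ess_bounded a I g"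
    and u: "\<And>t. t \<in> I \<Longrightarrow> u t = rl_integral_raw \<alpha> a g t"
  shows "continuous_on I u" "u \<in> rl_AC \<alpha> a I" "negligible {t\<in>I. \<not> has_rl_derivative \<alpha> a I u (g t) t}"
proof -
  let ?G = "\<lambda>t. integral {a..t} g"
  show cont: "continuous_on I u"
    using rl_integral_raw_continuous_on_interval[OF I \<alpha> g] u by (simp cong: continuous_on_cong)
  have int: "g integrable_on {a..c}" if "c \<in> I" for c
    using ess_bounded_integrable by (metis loc_ess_boundedE[OF g that])
  have "continuous_on I ?G"
    using int by (intro continuous_on_intervals_from[OF I] indefinite_integral_continuous_1)
  then have R: "rl_integral (1 - \<alpha>) a I u t = ?G t" if "t \<in> I" for t
    using rl_integral_raw_compose_loc[OF I \<alpha> g u] that by (intro rl_integral_eq_raw[OF I]) auto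
  show "u \<in> rl_AC \<alpha> a I"
    unfolding rl_AC_def using cont integral_AC_loc[OF I g R] by (simp add: continuous_on_imp_L1_loc)
  obtain D where D: "countable D" "D \<subseteq> I" "\<And>t. t \<in> I \<Longrightarrow> \<exists>c\<in>D. a < c \<and> t \<le> c \<and> at t within I = at t within {a..c}"
    using intervals_from_exhaustion[OF I] by metis
  let ?bad = "\<lambda>c. {x \<in> {a..c}. \<not> (?G has_real_derivative g x) (at x within {a..c})}"
  have "negligible (\<Union>(?bad ` D))"
  proof (intro negligible_countable_Union countable_image D(1))
    fix S assume "S \<in> ?bad ` D"
    then show "negligible S" using negligible_not_derivative_integral int D(2) by blast
  qed
  moreover have "{t\<in>I. \<not> has_rl_derivative \<alpha> a I u (g t) t} \<subseteq> \<Union>(?bad ` D)"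
  proof clarify
    fix t assume t: "t \<in> I" "\<not> has_rl_derivative \<alpha> a I u (g t) t"
    obtain c where c: "c \<in> D" "t \<le> c" "at t within I = at t within {a..c}" using D(3)[OF t(1)] by blast
    have "\<not> (?G has_real_derivative g t) (at t within I)"
    proof
      assume "(?G has_real_derivative g t) (at t within I)"
      then have "(rl_integral (1 - \<alpha>) a I u has_real_derivative g t) (at t within I)"
        by (rule has_field_derivative_transform_within[OF _ zero_less_one t(1)]) (simp add: R)
      then show False using t(2) by (simp add: has_rl_derivative_def)
    qed
    then have "t \<in> ?bad c" using c t(1) intervals_fromD(3)[OF I] by auto
    then show "t \<in> \<Union>(?bad ` D)" using c(1) by blast
  qed
  ultimately show "negligible {t\<in>I. \<not> has_rl_derivative \<alpha> a I u (g t) t}" by (rule negligible_subset)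
qed

lemma integral_zero_imp_zero:
  fixes w :: "real \<Rightarrow> real"
  assumes "a < c" "continuous_on {a..c} w" "\<And>t. t \<in> {a..c} \<Longrightarrow> integral {a..t} w = 0" "t \<in> {a..c}"
  shows "w t = 0"
proof -
  have "((\<lambda>t. integral {a..t} w) has_vector_derivative w t) (at t within {a..c})"
    using assms by (intro integral_has_vector_derivative)
  moreover have "((\<lambda>t. integral {a..t} w) has_vector_derivative 0) (at t within {a..c})"
    by (rule has_vector_derivative_transform[OF assms(4), of _ "\<lambda>_. 0"]) (use assms(3) in auto)
  ultimately show ?thesis
    using vector_derivative_unique_within_closed_interval[of a c t] assms by auto
qed

text \<open>The difference \<open>w\<close> of both sides has vanishing integral of order \<open>1 - \<alpha>\<close>; integrating to order
  \<open>\<alpha>\<close> once more annihilates all \<open>\<integral>\<^sub>a\<^sup>t w\<close>, and \<open>w\<close> is continuous.\<close>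
lemma rl_integral_of_rl_derivative:
  assumes I: "I \<in> intervals_from a" and \<alpha>: "0 < \<alpha>" "\<alpha> \<le> 1" and g: "loc_ess_bounded a I g"
    and u: "continuous_on I u" "u a = 0" "u \<in> rl_AC \<alpha> a I"
    and der: "negligible {t\<in>I. \<not> has_rl_derivative \<alpha> a I u (g t) t}" and t: "t \<in> I"
  shows "u t = rl_integral_raw \<alpha> a g t"
proof -
  have ub: "loc_ess_bounded a I u" by (rule continuous_on_imp_loc_ess_bounded[OF I u(1)])
  have "continuous_on I (rl_integral_raw (1 - \<alpha>) a u)"
  proof (cases "\<alpha> = 1")
    case True
    then show ?thesis using u(1) by (simp add: rl_integral_raw_def[abs_def])
  next
    case False
    then show ?thesis using \<alpha> ub by (intro rl_integral_raw_continuous_on_interval[OF I]) auto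
  qed
  then have R: "rl_integral (1 - \<alpha>) a I u s = rl_integral_raw (1 - \<alpha>) a u s" if "s \<in> I" for s
    using that by (intro rl_integral_eq_raw[OF I]) auto
  \<comment> \<open>For \<open>\<alpha> = 1\<close> this is \<open>u a = 0\<close>; for smaller
    orders it is an integral over a single point.\<close>
  have R0: "rl_integral_raw (1 - \<alpha>) a u a = 0"
    using u(2) \<alpha> rl_integral_raw_at_left_end[of "1 - \<alpha>" a u]
    by (cases "\<alpha> = 1") (auto simp: rl_integral_raw_def)
  have G: "rl_integral_raw (1 - \<alpha>) a u s = integral {a..s} g" if s: "s \<in> I" for s
  proof -
    let ?N = "{t\<in>I. \<not> has_rl_derivative \<alpha> a I u (g t) t}"
    have sub: "{a..s} \<subseteq> I" "a \<le> s" using intervals_fromD(3,4)[OF I s] by auto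
    have "(g has_integral (rl_integral (1 - \<alpha>) a I u s - rl_integral (1 - \<alpha>) a I u a)) {a..s}"
    proof (rule abs_cont_on_has_integral[OF sub(2) _ der])
      show "abs_cont_on a s (rl_integral (1 - \<alpha>) a I u)" using u(3) sub by (auto simp: rl_AC_def AC_loc_def)
      fix x assume "x \<in> {a..s} - ?N"
      then have "(rl_integral (1 - \<alpha>) a I u has_real_derivative g x) (at x within I)"
        using sub by (auto simp: has_rl_derivative_def)
      then show "(rl_integral (1 - \<alpha>) a I u has_real_derivative g x) (at x within {a..s})"
        using sub(1) by (rule DERIV_subset)
    qed
    then show ?thesis using R[OF s] R[OF intervals_fromD(1)[OF I]] R0 by (simp add: integral_unique)
  qed
  show ?thesis
  proof (cases "\<alpha> = 1")
    case True
    obtain M where "0 \<le> M" "ess_bounded {a..t} M g" by (rule loc_ess_boundedE[OF g t])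
    then show ?thesis using True G[OF t] rl_integral_raw_one[of a t M g] by (simp add: rl_integral_raw_def[of 0])
  next
    case False
    then have \<alpha>1: "0 < 1 - \<alpha>" "\<alpha> < 1" using \<alpha> by auto
    let ?v = "rl_integral_raw \<alpha> a g"
    let ?w = "\<lambda>s. u s - ?v s"
    have vc: "continuous_on I ?v" by (rule rl_integral_raw_continuous_on_interval[OF I \<alpha> g])
    have wc: "continuous_on I ?w" using u(1) vc by (intro continuous_intros)
    have w0: "rl_integral_raw (1 - \<alpha>) a ?w s = 0" if s: "s \<in> I" for s
    proof -
      obtain M where M: "0 \<le> M" "ess_bounded {a..s} M u" by (rule loc_ess_boundedE[OF ub s])
      obtain M' where M': "0 \<le> M'" "ess_bounded {a..s} M' ?v"
        by (rule loc_ess_boundedE[OF continuous_on_imp_loc_ess_bounded[OF I vc] s])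
      show ?thesis
        using rl_integral_raw_diff[OF \<alpha>1(1) M(2) M'(2) M(1) M'(1)] G[OF s]
          rl_integral_raw_compose_loc[OF I \<alpha> g refl s] by simp
    qed
    have int0: "integral {a..s} ?w = 0" if s: "s \<in> I" for s
    proof -
      obtain M where M: "0 \<le> M" "ess_bounded {a..s} M ?w"
        by (rule loc_ess_boundedE[OF continuous_on_imp_loc_ess_bounded[OF I wc] s])
      have "integral {a..s} ?w = rl_integral_raw \<alpha> a (rl_integral_raw (1 - \<alpha>) a ?w) s"
        using rl_integral_raw_compose[OF \<alpha>(1) \<alpha>1(2) M(2,1)] by simp
      also have "\<dots> = rl_integral_raw \<alpha> a (\<lambda>_. 0) s"
        using w0 intervals_fromD(4)[OF I s] \<alpha> by (intro rl_integral_raw_eqI) auto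
      also have "\<dots> = 0" by (simp add: rl_integral_raw_def set_lebesgue_integral_def)
      finally show ?thesis .
    qed
    \<comment> \<open>\<open>t\<close> may be \<open>a\<close> itself, and differentiating the
      vanishing primitive of \<open>?w\<close> at \<open>t\<close> needs a nondegenerate
      interval.\<close>
    obtain c where c: "c \<in> I" "a < c" "t \<le> c"
    proof -
      obtain c where "c \<in> I" "a < c" using intervals_fromD(5)[OF I] by blast
      then show thesis using that[of "max c t"] t by (auto simp: max_def split: if_splits)
    qed
    have "?w t = 0"
    proof (rule integral_zero_imp_zero[OF c(2), where w = ?w and t = t])
      show "continuous_on {a..c} ?w" using wc intervals_fromD(4)[OF I c(1)] by (rule continuous_on_subset)
      show "integral {a..s} ?w = 0" if "s \<in> {a..c}" for s
        using int0 intervals_fromD(4)[OF I c(1)] that by blast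
      show "t \<in> {a..c}" using c intervals_fromD(3)[OF I t] by simp
    qed
    then show ?thesis by simp
  qed
qed

section \<open>Cauchy problems\<close>

locale caputo_problem =
  fixes a :: real and J :: "real set" and \<Omega> :: "(real ^ 'n) set"
    and f :: "real ^ 'n \<Rightarrow> real \<Rightarrow> real ^ 'n" and qa \<alpha> :: "real ^ 'n"
  assumes J: "J \<in> intervals_from a"
    and open_domain: "open \<Omega>"
    and carath: "caratheodory \<Omega> J f"
    and order: "\<And>i. 0 < \<alpha> $ i \<and> \<alpha> $ i \<le> 1"
    and loc_bounded: "\<And>K c d. compact K \<Longrightarrow> K \<subseteq> \<Omega> \<Longrightarrow> {c..d} \<subseteq> J \<Longrightarrow>
           \<exists>M\<ge>0. \<forall>x\<in>K. AE t in lebesgue_on {c..d}. norm (f x t) \<le> M"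
    and loc_Lipschitz: "\<And>x t. x \<in> \<Omega> \<Longrightarrow> t \<in> J \<Longrightarrow>
           \<exists>R>0. \<exists>\<delta>>0. \<exists>L\<ge>0. cball x R \<subseteq> \<Omega> \<and>
             (\<forall>x1\<in>cball x R. \<forall>x2\<in>cball x R.
                AE \<tau> in lebesgue_on ({t - \<delta>..t + \<delta>} \<inter> J).
                  norm (f x2 \<tau> - f x1 \<tau>) \<le> L * norm (x2 - x1))"
begin

section \<open>Null sets independent of the state\<close>

lemma negligible_discontinuous: "negligible {t\<in>J. \<not> continuous_on \<Omega> (\<lambda>x. f x t)}"
  using carath AE_lebesgue_on_iff_negligible[OF intervals_fromD(6)[OF J]] by (simp add: caratheodory_def)

text \<open>Countably many states dense in \<open>K\<close> have a common null set. At every other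
  time at which \<open>f\<close> is continuous in the state, the bound passes to the closure of the
  dense set, that is, to all of \<open>K\<close>.\<close>

lemma negligible_not_bounded:
  assumes K: "compact K" "K \<subseteq> \<Omega>" and cd: "{c..d} \<subseteq> J"
  obtains M where "0 \<le> M" "negligible {t\<in>{c..d}. \<not> (\<forall>x\<in>K. norm (f x t) \<le> M)}"
proof -
  obtain M where M: "0 \<le> M" "\<And>x. x \<in> K \<Longrightarrow> AE t in lebesgue_on {c..d}. norm (f x t) \<le> M"
    using loc_bounded[OF K cd] by blast
  obtain D where D: "countable D" "D \<subseteq> K" "K \<subseteq> closure D" using separable by metis
  have cl: "closure D = K" using D K(1) by (simp add: closure_minimal compact_imp_closed subset_antisym)
  let ?bad = "\<lambda>x. {t\<in>{c..d}. \<not> norm (f x t) \<le> M}"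
  have neg: "negligible (?bad x)" if "x \<in> D" for x
    using M(2) that D(2) by (subst AE_lebesgue_on_iff_negligible[symmetric]) auto
  have "negligible (\<Union>(?bad ` D))"
    by (intro negligible_countable_Union countable_image D(1)) (use neg in blast)
  then have N: "negligible (\<Union>(?bad ` D) \<union> {t\<in>J. \<not> continuous_on \<Omega> (\<lambda>x. f x t)})"
    using negligible_discontinuous by (rule negligible_Un)
  show thesis
  proof (rule that[OF M(1) negligible_subset[OF N]], rule subsetI)
    fix t assume "t \<in> {t\<in>{c..d}. \<not> (\<forall>x\<in>K. norm (f x t) \<le> M)}"
    then obtain x where t: "t \<in> {c..d}" "x \<in> K" "\<not> norm (f x t) \<le> M" by blast
    show "t \<in> \<Union>(?bad ` D) \<union> {t\<in>J. \<not> continuous_on \<Omega> (\<lambda>x. f x t)}"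
    proof (rule ccontr)
      assume nt: "t \<notin> \<Union>(?bad ` D) \<union> {t\<in>J. \<not> continuous_on \<Omega> (\<lambda>x. f x t)}"
      then have "continuous_on \<Omega> (\<lambda>x. f x t)" using t(1) cd by blast
      then have "continuous_on (closure D) (\<lambda>x. norm (f x t))"
        unfolding cl using K(2) by (intro continuous_on_norm) (rule continuous_on_subset)
      then have "norm (f x t) \<le> M"
        by (rule continuous_le_on_closure) (use t nt cl in auto)
      then show False using t(3) by simp
    qed
  qed
qed

text \<open>The same argument for pairs: \<open>D \<times> D\<close> is countable and dense in the
  square of the ball, and the Lipschitz inequality is a closed condition on pairs wherever
  \<open>f\<close> is continuous in the state.\<close>

lemma negligible_not_Lipschitz:
  assumes x: "x \<in> \<Omega>" and t: "t \<in> J"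
  obtains R \<delta> L where "R > 0" "\<delta> > 0" "L \<ge> 0" "cball x R \<subseteq> \<Omega>"
    "negligible {\<tau>\<in>{t - \<delta>..t + \<delta>} \<inter> J.
       \<not> (\<forall>x1\<in>cball x R. \<forall>x2\<in>cball x R. norm (f x2 \<tau> - f x1 \<tau>) \<le> L * norm (x2 - x1))}"
proof -
  obtain R \<delta> L where *: "R > 0" "\<delta> > 0" "L \<ge> 0" "cball x R \<subseteq> \<Omega>"
    "\<And>x1 x2. x1 \<in> cball x R \<Longrightarrow> x2 \<in> cball x R \<Longrightarrow>
       AE \<tau> in lebesgue_on ({t - \<delta>..t + \<delta>} \<inter> J). norm (f x2 \<tau> - f x1 \<tau>) \<le> L * norm (x2 - x1)"
    using loc_Lipschitz[OF x t] by blast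
  let ?T = "{t - \<delta>..t + \<delta>} \<inter> J"
  have T: "?T \<in> sets lebesgue" using intervals_fromD(6)[OF J] by auto
  obtain D where D: "countable D" "D \<subseteq> cball x R" "cball x R \<subseteq> closure D" using separable by metis
  have cl: "closure D = cball x R" using D by (simp add: closure_minimal subset_antisym)
  let ?P = "\<lambda>p \<tau>. norm (f (snd p) \<tau> - f (fst p) \<tau>) \<le> L * norm (snd p - fst p)"
  let ?bad = "\<lambda>p. {\<tau>\<in>?T. \<not> ?P p \<tau>}"
  have neg: "negligible (?bad p)" if "p \<in> D \<times> D" for p
  proof -
    have "fst p \<in> cball x R" "snd p \<in> cball x R" using that D(2) by auto
    from *(5)[OF this] show ?thesis by (simp only: AE_lebesgue_on_iff_negligible[OF T])
  qed
  have "negligible (\<Union>(?bad ` (D \<times> D)))"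
    by (intro negligible_countable_Union countable_image countable_SIGMA D(1)) (use neg in blast)
  then have N: "negligible (\<Union>(?bad ` (D \<times> D)) \<union> {t\<in>J. \<not> continuous_on \<Omega> (\<lambda>x. f x t)})"
    using negligible_discontinuous by (rule negligible_Un)
  show thesis
  proof (rule that[OF *(1-4) negligible_subset[OF N]], rule subsetI)
    fix \<tau>
    assume "\<tau> \<in> {\<tau>\<in>?T. \<not> (\<forall>x1\<in>cball x R. \<forall>x2\<in>cball x R. norm (f x2 \<tau> - f x1 \<tau>) \<le> L * norm (x2 - x1))}"
    then obtain x1 x2 where t: "\<tau> \<in> ?T" "\<tau> \<in> J" "x1 \<in> cball x R" "x2 \<in> cball x R"
      "\<not> norm (f x2 \<tau> - f x1 \<tau>) \<le> L * norm (x2 - x1)" by blast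
    show "\<tau> \<in> \<Union>(?bad ` (D \<times> D)) \<union> {t\<in>J. \<not> continuous_on \<Omega> (\<lambda>x. f x t)}"
    proof (rule ccontr)
      assume nt: "\<tau> \<notin> \<Union>(?bad ` (D \<times> D)) \<union> {t\<in>J. \<not> continuous_on \<Omega> (\<lambda>x. f x t)}"
      then have "continuous_on \<Omega> (\<lambda>x. f x \<tau>)" using t(2) by blast
      then have "continuous_on (cball x R) (\<lambda>x. f x \<tau>)" using *(4) by (rule continuous_on_subset)
      then have "continuous_on (closure (D \<times> D)) (\<lambda>p. norm (f (snd p) \<tau> - f (fst p) \<tau>) - L * norm (snd p - fst p))"
        unfolding closure_Times cl
      proof -
        assume c: "continuous_on (cball x R) (\<lambda>x. f x \<tau>)"
        have "continuous_on (cball x R \<times> cball x R) (\<lambda>p. f (snd p) \<tau>)"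
          by (rule continuous_on_compose2[OF c]) (auto intro: continuous_intros)
        moreover have "continuous_on (cball x R \<times> cball x R) (\<lambda>p. f (fst p) \<tau>)"
          by (rule continuous_on_compose2[OF c]) (auto intro: continuous_intros)
        ultimately show "continuous_on (cball x R \<times> cball x R)
            (\<lambda>p. norm (f (snd p) \<tau> - f (fst p) \<tau>) - L * norm (snd p - fst p))"
          by (intro continuous_intros)
      qed
      then have "norm (f (snd (x1, x2)) \<tau> - f (fst (x1, x2)) \<tau>) - L * norm (snd (x1, x2) - fst (x1, x2)) \<le> 0"
      proof (rule continuous_le_on_closure)
        show "(x1, x2) \<in> closure (D \<times> D)" using t by (simp add: closure_Times cl)
        fix p assume "p \<in> D \<times> D"
        then show "norm (f (snd p) \<tau> - f (fst p) \<tau>) - L * norm (snd p - fst p) \<le> 0"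
          using t(1) nt by auto
      qed
      then show False using t(5) by simp
    qed
  qed
qed

section \<open>Measurability and local boundedness of the right-hand side along a curve\<close>

text \<open>\<open>f (q (s n (k n t))) t\<close> with sampling points \<open>s n (k n t)\<close> tending to \<open>t\<close> from the left takes,
  for each \<open>n\<close>, only countably many values of its first argument.\<close>
lemma superposition_measurable:
  assumes I: "I \<in> intervals_from a" "I \<subseteq> J" and q: "continuous_on I q" "\<And>t. t \<in> I \<Longrightarrow> q t \<in> \<Omega>"
  shows "(\<lambda>t. f (q t) t) \<in> borel_measurable (lebesgue_on I)"
proof -
  have Is: "I \<in> sets lebesgue" by (rule intervals_fromD(6)[OF I(1)])
  \<comment> \<open>Rounding down places the sampling point in \<open>[a, t]\<close>, hence in
    \<open>I\<close>, where \<open>q\<close> is continuous with values in the domain.\<close>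
  define k where "k n t = \<lfloor>real (Suc n) * (t - a)\<rfloor>" for n t
  define s where "s n i = a + of_int i / real (Suc n)" for n and i :: int
  \<comment> \<open>The countable composition rule asks for measurability for every integer
    \<open>i\<close>, also when \<open>s n i\<close> is outside \<open>I\<close> and nothing is
    known about \<open>q\<close> there; the value 0 covers those cases.\<close>
  define G where "G n i t = (if s n i \<in> I then f (q (s n i)) t else 0)" for n i t
  have s1: "s n (k n t) \<in> {a..t}" "t - s n (k n t) \<le> 1 / real (Suc n)" if "t \<in> I" for n t
  proof -
    have "a \<le> t" by (rule intervals_fromD(3)[OF I(1) that])
    then have "0 \<le> k n t" by (simp add: k_def)
    moreover have "of_int (k n t) \<le> real (Suc n) * (t - a)" "real (Suc n) * (t - a) \<le> of_int (k n t) + 1"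
      unfolding k_def by linarith+
    then have "of_int (k n t) / real (Suc n) \<le> t - a" "t - a \<le> (of_int (k n t) + 1) / real (Suc n)"
      by (simp_all only: divide_le_eq le_divide_eq mult.commute[of "t - a"] of_nat_0_less_iff if_True zero_less_Suc)
    ultimately show "s n (k n t) \<in> {a..t}" "t - s n (k n t) \<le> 1 / real (Suc n)"
      by (auto simp: s_def add_divide_distrib)
  qed
  have "(\<lambda>t. f (q t) t) measurable_on I"
  proof (rule measurable_on_limit[OF _ negligible_discontinuous])
    fix n
    have "(\<lambda>t. G n (k n t) t) \<in> borel_measurable (lebesgue_on I)"
    proof (rule measurable_compose_countable)
      fix i :: int
      have "f x \<in> borel_measurable (lebesgue_on I)" if "x \<in> \<Omega>" for x
        using carath that I(2) unfolding caratheodory_def by (auto intro: measurable_restrict_mono)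
      then show "(\<lambda>t. G n i t) \<in> borel_measurable (lebesgue_on I)"
        unfolding G_def using q(2) by (cases "s n i \<in> I") simp_all
      have "k n \<in> measurable borel (count_space UNIV)"
        unfolding k_def by measurable
      then show "k n \<in> measurable (lebesgue_on I) (count_space UNIV)"
        by (intro measurable_restrict_space1 measurable_completion) simp
    qed
    then show "(\<lambda>t. G n (k n t) t) measurable_on I" using Is by (simp add: measurable_on_iff_borel_measurable)
  next
    fix t assume t: "t \<in> I - {t\<in>J. \<not> continuous_on \<Omega> (\<lambda>x. f x t)}"
    then have ft: "continuous_on \<Omega> (\<lambda>x. f x t)" "t \<in> I" using I(2) by auto
    have sI: "s n (k n t) \<in> I" for n using s1(1)[OF ft(2), of n] intervals_fromD(4)[OF I(1) ft(2)] by blast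
    have "(\<lambda>n. s n (k n t)) \<longlonglongrightarrow> t"
    proof (rule tendsto_sandwich[of "\<lambda>n. t - 1 / real (Suc n)" _ _ "\<lambda>n. t"])
      show "(\<lambda>n. t - 1 / real (Suc n)) \<longlonglongrightarrow> t"
        using tendsto_diff[OF tendsto_const[of t] LIMSEQ_inverse_real_of_nat] by (simp add: divide_inverse)
      show "\<forall>\<^sub>F n in sequentially. t - 1 / real (Suc n) \<le> s n (k n t)"
        using s1(2)[OF ft(2)] by (intro always_eventually allI) (simp add: algebra_simps)
      show "\<forall>\<^sub>F n in sequentially. s n (k n t) \<le> t"
        using s1(1)[OF ft(2)] by (intro always_eventually allI) simp
    qed simp
    then have "(\<lambda>n. q (s n (k n t))) \<longlonglongrightarrow> q t"
      by (rule continuous_on_tendsto_compose[OF q(1) _ ft(2)]) (simp add: sI)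
    then have "(\<lambda>n. f (q (s n (k n t))) t) \<longlonglongrightarrow> f (q t) t"
      by (rule continuous_on_tendsto_compose[OF ft(1)]) (use q(2) sI ft(2) in auto)
    then show "(\<lambda>n. G n (k n t) t) \<longlonglongrightarrow> f (q t) t" by (simp add: G_def sI)
  qed
  then show ?thesis using Is by (simp add: measurable_on_iff_borel_measurable)
qed

lemma superposition_ess_bounded:
  assumes I: "I \<in> intervals_from a" "I \<subseteq> J" and q: "continuous_on I q" "\<And>t. t \<in> I \<Longrightarrow> q t \<in> \<Omega>"
    and M: "S \<subseteq> I" "negligible {t\<in>S. \<not> norm (f (q t) t) \<le> M}"
  shows "ess_bounded S M (\<lambda>t. f (q t) t $ i)"
  unfolding ess_bounded_def
proof
  have "(\<lambda>t. f (q t) t $ i) \<in> borel_measurable (lebesgue_on I)"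
    by (rule measurable_compose[OF superposition_measurable[OF I q] borel_measurable_nth])
  then show "(\<lambda>t. f (q t) t $ i) \<in> borel_measurable (lebesgue_on S)"
    using M(1) by (rule measurable_restrict_mono)
  show "negligible {t \<in> S. \<not> \<bar>f (q t) t $ i\<bar> \<le> M}"
    by (rule negligible_subset[OF M(2)]) (use component_le_norm_cart order_trans in blast)
qed

text \<open>On \<open>{a..c}\<close> the curve \<open>q\<close> fills only a compact subset of the
  domain, to which the local bound on \<open>f\<close> applies.\<close>

lemma superposition_loc_ess_bounded:
  assumes I: "I \<in> intervals_from a" "I \<subseteq> J" and q: "continuous_on I q" "\<And>t. t \<in> I \<Longrightarrow> q t \<in> \<Omega>"
  shows "loc_ess_bounded a I (\<lambda>t. f (q t) t $ i)"
  unfolding loc_ess_bounded_def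
proof
  fix c assume c: "c \<in> I"
  have sub: "{a..c} \<subseteq> I" by (rule intervals_fromD(4)[OF I(1) c])
  have K: "compact (q ` {a..c})"
    using sub q(1) by (intro compact_continuous_image continuous_on_subset[OF q(1)]) auto
  obtain M where M: "0 \<le> M" "negligible {t\<in>{a..c}. \<not> (\<forall>x\<in>q ` {a..c}. norm (f x t) \<le> M)}"
    using negligible_not_bounded[OF K, of a c] sub I(2) q(2) by blast
  have "negligible {t\<in>{a..c}. \<not> norm (f (q t) t) \<le> M}"
    by (rule negligible_subset[OF M(2)]) auto
  then show "\<exists>M\<ge>0. ess_bounded {a..c} M (\<lambda>t. f (q t) t $ i)"
    using superposition_ess_bounded[OF I q sub] M(1) by blast
qed

section \<open>Equivalence with the Volterra equation\<close>

lemma continuous_on_vec_iff: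
  fixes q :: "real \<Rightarrow> real ^ 'n"
  shows "continuous_on I q \<longleftrightarrow> (\<forall>i. continuous_on I (\<lambda>t. q t $ i))"
proof
  assume "\<forall>i. continuous_on I (\<lambda>t. q t $ i)"
  then have "continuous_on I (\<lambda>t. \<chi> i. q t $ i)" by (intro continuous_on_vec_lambda) auto
  then show "continuous_on I q" by simp
qed (auto intro!: continuous_intros)

text \<open>After this, extensions are checked without derivatives or representatives: the integral
  equation holds pointwise, its right side at \<open>t\<close> involves only the past of
  \<open>t\<close>, and it is insensitive to changes of the integrand on null sets.\<close>

lemma local_solution_iff:
  assumes I: "I \<in> intervals_from a" "I \<subseteq> J"
  shows "local_solution \<Omega> J f \<alpha> a qa q I \<longleftrightarrow> continuous_on I q \<and> (\<forall>t\<in>I. q t \<in> \<Omega>) \<and>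
    (\<forall>t\<in>I. \<forall>i. q t $ i = qa $ i + rl_integral_raw (\<alpha> $ i) a (\<lambda>s. f (q s) s $ i) t)"
    (is "?sol \<longleftrightarrow> ?cont \<and> ?val \<and> ?eq")
proof
  note Is = intervals_fromD(6)[OF I(1)]
  assume sol: ?sol
  then have val: ?val and qa': "q a = qa" and ac: "\<And>i. (\<lambda>t. q t $ i) \<in> caputo_AC (\<alpha> $ i) a I"
    and der: "AE t in lebesgue_on I. has_caputo_derivative_vec \<alpha> a I q (f (q t) t) t"
    by (auto simp: local_solution_def caputo_AC_vec_def)
  have cont: ?cont using ac by (auto simp: continuous_on_vec_iff caputo_AC_def)
  have ?eq
  proof (intro ballI allI)
    fix t i assume t: "t \<in> I"
    have "q t $ i - q a $ i = rl_integral_raw (\<alpha> $ i) a (\<lambda>s. f (q s) s $ i) t"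
    proof (rule rl_integral_of_rl_derivative[OF I(1) _ _ _ _ _ _ _ t])
      show "loc_ess_bounded a I (\<lambda>s. f (q s) s $ i)"
        using cont val by (intro superposition_loc_ess_bounded[OF I]) auto
      show "continuous_on I (\<lambda>t. q t $ i - q a $ i)" using cont by (intro continuous_intros)
      show "(\<lambda>t. q t $ i - q a $ i) \<in> rl_AC (\<alpha> $ i) a I" using ac by (simp add: caputo_AC_def)
      have "negligible {t\<in>I. \<not> has_caputo_derivative_vec \<alpha> a I q (f (q t) t) t}"
        using der by (simp add: AE_lebesgue_on_iff_negligible[OF Is])
      then show "negligible {t\<in>I. \<not> has_rl_derivative (\<alpha> $ i) a I (\<lambda>t. q t $ i - q a $ i) (f (q t) t $ i) t}"
        by (rule negligible_subset) (auto simp: has_caputo_derivative_vec_def has_caputo_derivative_def)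
    qed (use order in auto)
    then show "q t $ i = qa $ i + rl_integral_raw (\<alpha> $ i) a (\<lambda>s. f (q s) s $ i) t" by (simp add: qa')
  qed
  with cont val show "?cont \<and> ?val \<and> ?eq" by blast
next
  note Is = intervals_fromD(6)[OF I(1)]
  assume "?cont \<and> ?val \<and> ?eq"
  then have cont: ?cont and val: ?val and eq: ?eq by blast+
  have qa': "q a = qa"
    using eq intervals_fromD(1)[OF I(1)] order by (simp add: vec_eq_iff rl_integral_raw_at_left_end)
  have *: "(\<lambda>t. q t $ i - q a $ i) \<in> rl_AC (\<alpha> $ i) a I"
    "negligible {t\<in>I. \<not> has_rl_derivative (\<alpha> $ i) a I (\<lambda>t. q t $ i - q a $ i) (f (q t) t $ i) t}" for i
  proof -
    have g: "loc_ess_bounded a I (\<lambda>s. f (q s) s $ i)"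
      using cont val by (intro superposition_loc_ess_bounded[OF I]) auto
    have u: "q t $ i - q a $ i = rl_integral_raw (\<alpha> $ i) a (\<lambda>s. f (q s) s $ i) t" if "t \<in> I" for t
      using eq that qa' by simp
    show "(\<lambda>t. q t $ i - q a $ i) \<in> rl_AC (\<alpha> $ i) a I"
      "negligible {t\<in>I. \<not> has_rl_derivative (\<alpha> $ i) a I (\<lambda>t. q t $ i - q a $ i) (f (q t) t $ i) t}"
      using rl_derivative_of_rl_integral(2,3)[OF I(1) _ _ g u] order by blast+
  qed
  have "negligible (\<Union>i. {t\<in>I. \<not> has_rl_derivative (\<alpha> $ i) a I (\<lambda>t. q t $ i - q a $ i) (f (q t) t $ i) t})"
    by (intro negligible_Union) (use *(2) in auto)
  moreover have "(\<Union>i. {t\<in>I. \<not> has_rl_derivative (\<alpha> $ i) a I (\<lambda>t. q t $ i - q a $ i) (f (q t) t $ i) t})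
      = {t\<in>I. \<not> has_caputo_derivative_vec \<alpha> a I q (f (q t) t) t}"
    by (auto simp: has_caputo_derivative_vec_def has_caputo_derivative_def)
  ultimately have "AE t in lebesgue_on I. has_caputo_derivative_vec \<alpha> a I q (f (q t) t) t"
    by (simp add: AE_lebesgue_on_iff_negligible[OF Is])
  then show ?sol
    using I qa' cont val *(1) by (auto simp: local_solution_def caputo_AC_vec_def caputo_AC_def continuous_on_vec_iff)
qed
end

section \<open>Continuation of solutions\<close>

lemma Icc_intervals_from: "a < c \<Longrightarrow> {a..c} \<in> intervals_from a"
  and Ico_intervals_from: "a < c \<Longrightarrow> {a..<c} \<in> intervals_from a"
proof -
  show "{a..c} \<in> intervals_from a" if "a < c"
    using that by (auto simp: intervals_from_def is_interval_1)
  show "{a..<c} \<in> intervals_from a" if "a < c"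
  proof -
    have "(a + c) / 2 \<in> {a..<c}" "(a + c) / 2 \<noteq> a" using that by auto
    then have "{a} \<noteq> {a..<c}" by (metis singletonD)
    then have "{a} \<subset> {a..<c}" using that by auto
    then show ?thesis by (auto simp: intervals_from_def is_interval_1)
  qed
qed

text \<open>For a solution on \<open>[a, b)\<close> the right-hand side is controlled only before
  \<open>b\<close>, while the integral estimates use closed intervals. The missing point is null,
  whatever value is taken there.\<close>

lemma ess_bounded_insert:
  assumes "ess_bounded S M g" "S \<in> sets lebesgue"
  shows "ess_bounded (insert x S) M g"
  unfolding ess_bounded_def
proof
  have "g measurable_on S" using assms by (simp add: ess_bounded_def measurable_on_iff_borel_measurable)
  then have "g measurable_on (insert x S)"
    by (rule measurable_on_spike_set) (rule negligible_subset[of "{x}"], auto)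
  moreover have "insert x S \<in> sets lebesgue"
    using sets.Un[of "{x}" lebesgue S] assms(2) by simp
  ultimately show "g \<in> borel_measurable (lebesgue_on (insert x S))"
    by (simp add: measurable_on_iff_borel_measurable)
  show "negligible {t \<in> insert x S. \<not> \<bar>g t\<bar> \<le> M}"
    by (rule negligible_subset[of "insert x {t \<in> S. \<not> \<bar>g t\<bar> \<le> M}"]) (use assms in \<open>auto simp: ess_bounded_def\<close>)
qed

text \<open>One step length has to serve all orders at once. Every exponent is positive, so the
  finite sum tends to 0 as \<open>h\<close> decreases to 0.\<close>

lemma exists_small_sum_powr:
  fixes \<alpha> :: "'i::finite \<Rightarrow> real"
  assumes "\<And>i. 0 < \<alpha> i" "0 < \<epsilon>" "0 < m"
  obtains h where "0 < h" "h < m" "(\<Sum>i\<in>UNIV. h powr \<alpha> i / Gamma (\<alpha> i + 1)) < \<epsilon>"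
proof -
  have "((\<lambda>h. \<Sum>i\<in>UNIV. h powr \<alpha> i / Gamma (\<alpha> i + 1)) \<longlongrightarrow> (\<Sum>i\<in>UNIV. 0 powr \<alpha> i / Gamma (\<alpha> i + 1))) (at_right 0)"
  proof (intro tendsto_sum tendsto_divide tendsto_powr' tendsto_const)
    fix i
    show "0 \<noteq> (0::real) \<or> \<alpha> i > 0 \<and> (\<forall>\<^sub>F x in at_right (0::real). 0 \<le> x)"
      using assms(1)[of i] eventually_mono[OF eventually_at_right_less[of "0::real"], of "\<lambda>x. 0 \<le> x"] by simp
    have "0 < Gamma (\<alpha> i + 1)" using assms(1)[of i] by (intro Gamma_real_pos) simp
    then show "Gamma (\<alpha> i + 1) \<noteq> 0" by simp
  qed (rule tendsto_ident_at)
  then have "\<forall>\<^sub>F h in at_right 0. (\<Sum>i\<in>UNIV. h powr \<alpha> i / Gamma (\<alpha> i + 1)) < \<epsilon>"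
    using order_tendstoD(2)[of _ 0 _ \<epsilon>] assms(2) by simp
  moreover have "\<forall>\<^sub>F h in at_right 0. h \<in> {0<..<m}"
    using eventually_at_right_real[OF assms(3)] .
  ultimately have "\<forall>\<^sub>F h in at_right 0. h \<in> {0<..<m} \<and> (\<Sum>i\<in>UNIV. h powr \<alpha> i / Gamma (\<alpha> i + 1)) < \<epsilon>"
    by eventually_elim simp
  then have "\<exists>h. h \<in> {0<..<m} \<and> (\<Sum>i\<in>UNIV. h powr \<alpha> i / Gamma (\<alpha> i + 1)) < \<epsilon>"
    using eventually_happens'[OF trivial_limit_at_right_real[of 0]] by blast
  then show thesis using that by auto
qed

context caputo_problem
begin

lemma extend_to_right_end:
  assumes ab: "a < b" and b: "b \<in> J" and sol: "local_solution \<Omega> J f \<alpha> a qa q {a..<b}"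
    and K: "compact K" "K \<subseteq> \<Omega>" "\<And>t. t \<in> {a..<b} \<Longrightarrow> q t \<in> K"
  obtains q' where "local_solution \<Omega> J f \<alpha> a qa q' {a..b}" "\<And>t. t \<in> {a..<b} \<Longrightarrow> q' t = q t"
proof -
  have sub: "{a..b} \<subseteq> J" by (rule intervals_fromD(4)[OF J b])
  note I = Ico_intervals_from[OF ab] and I' = Icc_intervals_from[OF ab]
  have IJ: "{a..<b} \<subseteq> J" using sub by auto
  have cont: "continuous_on {a..<b} q" and val: "\<And>t. t \<in> {a..<b} \<Longrightarrow> q t \<in> \<Omega>"
    and eq: "\<And>t i. t \<in> {a..<b} \<Longrightarrow> q t $ i = qa $ i + rl_integral_raw (\<alpha> $ i) a (\<lambda>s. f (q s) s $ i) t"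
    using sol unfolding local_solution_iff[OF I IJ] by blast+
  obtain M where M: "0 \<le> M" "negligible {t\<in>{a..b}. \<not> (\<forall>x\<in>K. norm (f x t) \<le> M)}"
    using negligible_not_bounded[OF K(1,2) sub] .
  have ess: "ess_bounded {a..b} M (\<lambda>t. f (q t) t $ i)" for i
  proof -
    have "negligible {t\<in>{a..<b}. \<not> norm (f (q t) t) \<le> M}"
      by (rule negligible_subset[OF M(2)]) (use K(3) in auto)
    then have "ess_bounded {a..<b} M (\<lambda>t. f (q t) t $ i)"
      using val by (intro superposition_ess_bounded[OF I IJ cont]) auto
    moreover have "insert b {a..<b} = {a..b}" using ab by auto
    ultimately show ?thesis using ess_bounded_insert[of "{a..<b}" M "\<lambda>t. f (q t) t $ i" b] by simp
  qed
  \<comment> \<open>The right side of the Volterra equation makes sense at \<open>b\<close> as well,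
    because the unspecified value \<open>q b\<close> does not affect the integral. It agrees with
    \<open>q\<close> before \<open>b\<close> and supplies the new endpoint value.\<close>
  define v where "v i t = qa $ i + rl_integral_raw (\<alpha> $ i) a (\<lambda>s. f (q s) s $ i) t" for i t
  define q' where "q' t = (if t < b then q t else \<chi> i. v i t)" for t
  have q'v: "q' t $ i = v i t" if "t \<in> {a..b}" for t i
    using that eq by (auto simp: q'_def v_def)
  have q'q: "q' t = q t" if "t \<in> {a..<b}" for t using that by (simp add: q'_def)
  have v_cont: "continuous_on {a..b} (v i)" for i
    unfolding v_def using order M(1) ess by (intro continuous_intros rl_integral_raw_continuous_on) auto
  have cont': "continuous_on {a..b} q'"
    unfolding continuous_on_vec_iff by (intro allI continuous_on_eq[OF v_cont]) (simp add: q'v)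
  \<comment> \<open>Closedness of \<open>K\<close> keeps the limit at \<open>b\<close> in
    \<open>K\<close>, and so inside the domain.\<close>
  have "q' ` closure {a..<b} \<subseteq> K"
    by (rule image_closure_subset) (use ab cont' K q'q in \<open>auto simp: compact_imp_closed\<close>)
  then have q'K: "q' t \<in> K" if "t \<in> {a..b}" for t using that ab by auto
  have "local_solution \<Omega> J f \<alpha> a qa q' {a..b}"
    unfolding local_solution_iff[OF I' sub]
  proof (intro conjI ballI allI cont')
    show "q' t \<in> \<Omega>" if "t \<in> {a..b}" for t using q'K[OF that] K(2) by blast
    fix t i assume t: "t \<in> {a..b}"
    have "rl_integral_raw (\<alpha> $ i) a (\<lambda>s. f (q' s) s $ i) t = rl_integral_raw (\<alpha> $ i) a (\<lambda>s. f (q s) s $ i) t"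
    proof (rule rl_integral_raw_cong)
      show "ess_bounded {a..t} M (\<lambda>s. f (q s) s $ i)" by (rule ess_bounded_subset[OF ess]) (use t in auto)
      show "negligible {s \<in> {a..t}. f (q' s) s $ i \<noteq> f (q s) s $ i}"
      proof (rule negligible_subset[of "{b}"])
        show "{s \<in> {a..t}. f (q' s) s $ i \<noteq> f (q s) s $ i} \<subseteq> {b}" using t by (auto simp: q'_def)
      qed simp
    qed (use order M in auto)
    then show "q' t $ i = qa $ i + rl_integral_raw (\<alpha> $ i) a (\<lambda>s. f (q' s) s $ i) t"
      using q'v[OF t] by (simp add: v_def)
  qed
  then show thesis using q'q by (rule that)
qed

lemma extend_beyond:
  assumes ab: "a < b" and T: "T \<in> J" "b < T" and sol: "local_solution \<Omega> J f \<alpha> a qa q {a..b}"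
  obtains c q' where "b < c" "local_solution \<Omega> J f \<alpha> a qa q' {a..c}" "\<And>t. t \<in> {a..b} \<Longrightarrow> q' t = q t"
proof -
  have sub: "{a..T} \<subseteq> J" by (rule intervals_fromD(4)[OF J T(1)])
  note I = Icc_intervals_from[OF ab]
  have IJ: "{a..b} \<subseteq> J" using sub T by auto
  have cont: "continuous_on {a..b} q" and val: "\<And>t. t \<in> {a..b} \<Longrightarrow> q t \<in> \<Omega>"
    and eq: "\<And>t i. t \<in> {a..b} \<Longrightarrow> q t $ i = qa $ i + rl_integral_raw (\<alpha> $ i) a (\<lambda>s. f (q s) s $ i) t"
    using sol unfolding local_solution_iff[OF I IJ] by blast+
  have bI: "b \<in> {a..b}" using ab by simp
  obtain R \<delta> L where R: "R > 0" "\<delta> > 0" "L \<ge> 0" "cball (q b) R \<subseteq> \<Omega>"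
    and Lip: "negligible {\<tau>\<in>{b - \<delta>..b + \<delta>} \<inter> J.
       \<not> (\<forall>x1\<in>cball (q b) R. \<forall>x2\<in>cball (q b) R. norm (f x2 \<tau> - f x1 \<tau>) \<le> L * norm (x2 - x1))}"
    using negligible_not_Lipschitz[OF val[OF bI]] bI IJ by blast
  \<comment> \<open>The past and the ball are taken together, so that a single bound
    \<open>M\<close> holds along \<open>q\<close> and along every candidate continuation.\<close>
  define K where "K = q ` {a..b} \<union> cball (q b) R"
  have K: "compact K" "K \<subseteq> \<Omega>"
  proof -
    show "compact K"
      unfolding K_def by (intro compact_Un compact_continuous_image cont compact_Icc compact_cball)
    show "K \<subseteq> \<Omega>" unfolding K_def using val R(4) by blast
  qed
  obtain M where M: "0 \<le> M" "negligible {t\<in>{a..T}. \<not> (\<forall>x\<in>K. norm (f x t) \<le> M)}"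
    using negligible_not_bounded[OF K sub] .
  \<comment> \<open>Norms are estimated by the sum of the components, each of which contributes the
    power of its own order.\<close>
  define \<phi> where "\<phi> h = (\<Sum>i\<in>UNIV. h powr (\<alpha> $ i) / Gamma (\<alpha> $ i + 1))" for h
  \<comment> \<open>The first bound on \<open>\<phi> h\<close> gives
    \<open>2 * M * \<phi> h \<le> R\<close>, where 2 is the Hoelder factor, so candidates stay in
    the ball. The second gives the contraction constant 1/2. The added ones avoid division by zero
    for \<open>M = 0\<close> or \<open>L = 0\<close>. The bound on \<open>h\<close> keeps times
    inside the Lipschitz window and before \<open>T\<close>.\<close>
  obtain h where h: "0 < h" "h < min \<delta> (T - b)" "\<phi> h < min (R / (2 * M + 1)) (1 / (2 * (L + 1)))"
    unfolding \<phi>_def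
    using exists_small_sum_powr[of "\<lambda>i. \<alpha> $ i" "min (R / (2 * M + 1)) (1 / (2 * (L + 1)))" "min \<delta> (T - b)"]
      order R M(1) T(2) by auto
  have \<phi>_mono: "\<phi> x \<le> \<phi> h" if "0 \<le> x" "x \<le> h" for x
    unfolding \<phi>_def
  proof (intro sum_mono divide_right_mono)
    fix i
    show "x powr \<alpha> $ i \<le> h powr \<alpha> $ i" using that order[of i] by (intro powr_mono2) auto
    show "0 \<le> Gamma (\<alpha> $ i + 1)" using Gamma_real_pos[of "\<alpha> $ i + 1"] order[of i] by simp
  qed
  have \<phi>0: "0 \<le> \<phi> h"
    unfolding \<phi>_def using order Gamma_real_pos by (intro sum_nonneg divide_nonneg_nonneg) (auto simp: less_imp_le add_pos_pos)
  have \<phi>R: "2 * M * \<phi> h \<le> R"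
  proof -
    have "(2 * M + 1) * \<phi> h < R" using h(3) M(1) by (simp add: field_simps)
    then show ?thesis using \<phi>0 by (simp add: algebra_simps)
  qed
  have \<phi>L: "L * \<phi> h \<le> 1 / 2"
  proof -
    have "(L + 1) * \<phi> h < 1 / 2" using h(3) R(3) by (simp add: field_simps)
    then show ?thesis using \<phi>0 by (simp add: algebra_simps)
  qed
  define c where "c = b + h"
  have c: "b < c" "c < T" "c < b + \<delta>" "a < c" using h ab by (auto simp: c_def)
  note I' = Icc_intervals_from[OF c(4)]
  have IJ': "{a..c} \<subseteq> J" using sub c by auto
  \<comment> \<open>Bounded continuous functions on the whole line form a complete space, and these
    constraints cut out a closed subset. The prescribed value at \<open>b\<close> makes gluing with
    \<open>q\<close> continuous.\<close>
  define S :: "(real \<Rightarrow>\<^sub>C (real ^ 'n)) set" where "S = PiC UNIV (\<lambda>t. if t = b then {q b} else cball (q b) R)"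
  have SD: "apply_bcontfun Y b = q b" "apply_bcontfun Y t \<in> cball (q b) R" if "Y \<in> S" for Y t
  proof -
    have *: "apply_bcontfun Y t \<in> (if t = b then {q b} else cball (q b) R)" for t
      using that unfolding S_def mem_PiC_iff by blast
    show "apply_bcontfun Y b = q b" using *[of b] by simp
    then show "apply_bcontfun Y t \<in> cball (q b) R" using *[of t] R(1) by (cases "t = b") simp_all
  qed
  have SI: "Y \<in> S" if "apply_bcontfun Y b = q b" "\<And>t. apply_bcontfun Y t \<in> cball (q b) R" for Y
    using that unfolding S_def mem_PiC_iff by auto
  define glue where "glue Y t = (if t \<le> b then q t else apply_bcontfun Y t)" for Y t
  have glue_cont: "continuous_on {a..c} (glue Y)" if "Y \<in> S" for Y
  proof -
    have "continuous_on ({a..b} \<union> {b..c}) (\<lambda>t. if t \<le> b then q t else apply_bcontfun Y t)"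
      by (rule continuous_on_If) (use cont SD(1)[OF that] in auto)
    moreover have "{a..b} \<union> {b..c} = {a..c}" using ab c by auto
    ultimately show ?thesis by (simp add: glue_def[abs_def])
  qed
  have glue_K: "glue Y t \<in> K" if "Y \<in> S" "t \<in> {a..c}" for Y t
    using that SD(2)[OF that(1)] by (auto simp: glue_def K_def)
  define g where "g Y i t = f (glue Y t) t $ i" for Y i t
  have g_ess: "ess_bounded {a..s} M (g Y i)" if "Y \<in> S" "s \<le> c" for Y i s
    unfolding g_def
  proof (rule superposition_ess_bounded[OF I' IJ' glue_cont[OF that(1)]])
    show "glue Y t \<in> \<Omega>" if "t \<in> {a..c}" for t using glue_K[OF \<open>Y \<in> S\<close> that] K(2) by blast
    show "{a..s} \<subseteq> {a..c}" using that by auto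
    show "negligible {t \<in> {a..s}. \<not> norm (f (glue Y t) t) \<le> M}"
      by (rule negligible_subset[OF M(2)]) (use that c glue_K[OF that(1)] in auto)
  qed
  have g_eq: "rl_integral_raw (\<alpha> $ i) a (g Y i) t = rl_integral_raw (\<alpha> $ i) a (\<lambda>s. f (q s) s $ i) t" if "t \<le> b" for Y i t
    using that order[of i] by (intro rl_integral_raw_eqI) (auto simp: g_def glue_def)
  \<comment> \<open>The integral still starts at \<open>a\<close>: its part over
    \<open>[a, b]\<close> changes with \<open>t\<close> and carries the memory. For
    \<open>t \<le> b\<close> it does not see \<open>Y\<close>, so there \<open>V Y\<close>
    reproduces \<open>q\<close>.\<close>
  define V where "V Y t = (\<chi> i. qa $ i + rl_integral_raw (\<alpha> $ i) a (g Y i) t)" for Y t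
  have V_q: "V Y t = q t" if "t \<in> {a..b}" for Y t
    using that eq[OF that] g_eq[of t] by (simp add: V_def vec_eq_iff)
  have V_cont: "continuous_on {a..c} (V Y)" if "Y \<in> S" for Y
    unfolding continuous_on_vec_iff
  proof
    fix i
    have "continuous_on {a..c} (rl_integral_raw (\<alpha> $ i) a (g Y i))"
      using order[of i] M(1) g_ess[OF that order_refl] by (intro rl_integral_raw_continuous_on) auto
    then show "continuous_on {a..c} (\<lambda>t. V Y t $ i)" unfolding V_def by (auto intro: continuous_intros)
  qed
  have V_ball: "V Y t \<in> cball (q b) R" if Y: "Y \<in> S" and t: "b \<le> t" "t \<le> c" for Y t
  proof -
    have "norm (V Y t - V Y b) \<le> (\<Sum>i\<in>UNIV. \<bar>(V Y t - V Y b) $ i\<bar>)" by (rule norm_le_l1_cart)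
    also have "\<dots> \<le> (\<Sum>i\<in>UNIV. 2 * M * ((t - b) powr (\<alpha> $ i) / Gamma (\<alpha> $ i + 1)))"
    proof (rule sum_mono)
      fix i
      show "\<bar>(V Y t - V Y b) $ i\<bar> \<le> 2 * M * ((t - b) powr (\<alpha> $ i) / Gamma (\<alpha> $ i + 1))"
        using rl_integral_raw_Holder[OF _ _ _ t(1) g_ess[OF Y t(2)] M(1), of "\<alpha> $ i"] order[of i] ab
        by (simp add: V_def)
    qed
    also have "\<dots> = 2 * M * \<phi> (t - b)" by (simp add: \<phi>_def sum_distrib_left)
    also have "\<dots> \<le> 2 * M * \<phi> h" using M(1) t by (intro mult_left_mono \<phi>_mono) (auto simp: c_def)
    also have "\<dots> \<le> R" by (rule \<phi>R)
    finally show ?thesis using V_q[OF bI] by (simp add: dist_norm norm_minus_commute)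
  qed
  \<comment> \<open>Extending \<open>V Y\<close> from \<open>[b, c]\<close> by its endpoint values
    gives a bounded continuous function on the line, with values still in the ball.\<close>
  define clamp where "clamp t = max b (min c t)" for t
  have clamp: "b \<le> clamp t" "clamp t \<le> c" for t using c by (auto simp: clamp_def)
  define P where "P Y = Bcontfun (\<lambda>t. V Y (clamp t))" for Y
  have P: "apply_bcontfun (P Y) t = V Y (clamp t)" if Y: "Y \<in> S" for Y t
  proof -
    have "continuous_on UNIV (\<lambda>t. V Y (clamp t))"
    proof (rule continuous_on_compose2[OF V_cont[OF Y]])
      show "continuous_on UNIV clamp" unfolding clamp_def by (intro continuous_intros)
      show "clamp ` UNIV \<subseteq> {a..c}" using clamp order_trans[OF less_imp_le[OF ab] clamp(1)] by auto
    qed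
    moreover have "bounded (range (\<lambda>t. V Y (clamp t)))"
      using V_ball[OF Y clamp] by (intro bounded_subset[OF bounded_cball[of "q b" R]]) auto
    ultimately have "(\<lambda>t. V Y (clamp t)) \<in> bcontfun" by (simp add: bcontfun_def)
    then show ?thesis unfolding P_def by (simp add: Bcontfun_inverse)
  qed
  have "\<exists>!Y\<in>S. P Y = Y"
  proof (rule Banach_fix[of S "1/2"])
    show "complete S" unfolding S_def complete_eq_closed by (rule closed_PiC) simp
    have "const_bcontfun (q b) \<in> S" using R(1) by (intro SI) (auto simp: const_bcontfun.rep_eq)
    then show "S \<noteq> {}" by blast
    show "P ` S \<subseteq> S"
    proof clarify
      fix Y assume Y: "Y \<in> S"
      show "P Y \<in> S"
      proof (rule SI)
        have "clamp b = b" using c by (simp add: clamp_def)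
        then show "apply_bcontfun (P Y) b = q b" using P[OF Y] V_q[OF bI] by simp
        show "apply_bcontfun (P Y) t \<in> cball (q b) R" for t using P[OF Y] V_ball[OF Y clamp] by simp
      qed
    qed
    fix Y Z assume YZ: "Y \<in> S" "Z \<in> S"
    show "dist (P Y) (P Z) \<le> 1 / 2 * dist Y Z"
    proof (rule dist_bound)
      fix t
      let ?s = "clamp t" and ?D = "dist Y Z"
      have "norm (V Y ?s - V Z ?s) \<le> (\<Sum>i\<in>UNIV. \<bar>(V Y ?s - V Z ?s) $ i\<bar>)" by (rule norm_le_l1_cart)
      also have "\<dots> \<le> (\<Sum>i\<in>UNIV. L * ?D * ((?s - b) powr (\<alpha> $ i) / Gamma (\<alpha> $ i + 1)))"
      proof (rule sum_mono)
        fix i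
        let ?d = "\<lambda>\<tau>. g Y i \<tau> - g Z i \<tau>"
        have eY: "ess_bounded {a..?s} M (g Y i)" and eZ: "ess_bounded {a..?s} M (g Z i)"
          using g_ess YZ clamp(2) by blast+
        have ed: "ess_bounded {a..?s} (M + M) ?d" by (rule ess_bounded_diff[OF eY eZ]) simp
        have "(V Y ?s - V Z ?s) $ i = rl_integral_raw (\<alpha> $ i) a ?d ?s"
          using rl_integral_raw_diff[OF _ eY eZ M(1) M(1)] order[of i] by (simp add: V_def)
        moreover have "\<bar>rl_integral_raw (\<alpha> $ i) a ?d ?s\<bar> \<le> L * ?D * (?s - b) powr (\<alpha> $ i) / Gamma (\<alpha> $ i + 1)"
        \<comment> \<open>Both integrands share the past up to \<open>b\<close>, so the estimate
          contains a power of \<open>?s - b\<close>. A power of \<open>?s - a\<close> would not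
          become small with \<open>h\<close>.\<close>
        proof (rule abs_rl_integral_raw_le[OF _ _ clamp(1)])
          have "{\<tau> \<in> {a..b}. ?d \<tau> \<noteq> 0} = {}" by (auto simp: g_def glue_def)
          then show "negligible {\<tau> \<in> {a..b}. ?d \<tau> \<noteq> 0}" by (simp only: negligible_empty)
          \<comment> \<open>The crude bound \<open>ed\<close> supplies measurability. The sharp
            constant comes from the Lipschitz condition: after \<open>b\<close> both states lie in
            the ball, and their distance is at most the sup distance \<open>?D\<close>.\<close>
          show "ess_bounded {a..?s} (L * ?D) ?d"
            unfolding ess_bounded_def
          proof
            show "?d \<in> borel_measurable (lebesgue_on {a..?s})" using ed by (simp add: ess_bounded_def)
            show "negligible {\<tau> \<in> {a..?s}. \<not> \<bar>?d \<tau>\<bar> \<le> L * ?D}"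
            proof (rule negligible_subset[OF Lip], rule subsetI)
              fix \<tau> assume "\<tau> \<in> {\<tau> \<in> {a..?s}. \<not> \<bar>?d \<tau>\<bar> \<le> L * ?D}"
              then have \<tau>: "a \<le> \<tau>" "\<tau> \<le> c" "\<not> \<bar>?d \<tau>\<bar> \<le> L * ?D" using clamp(2)[of t] by auto
              have "b < \<tau>"
              proof (rule ccontr)
                assume "\<not> b < \<tau>"
                then have "?d \<tau> = 0" by (simp add: g_def glue_def)
                then show False using \<tau>(3) R(3) by simp
              qed
              then have d: "?d \<tau> = (f (apply_bcontfun Y \<tau>) \<tau> - f (apply_bcontfun Z \<tau>) \<tau>) $ i"
                by (simp add: g_def glue_def)
              have "\<not> norm (f (apply_bcontfun Y \<tau>) \<tau> - f (apply_bcontfun Z \<tau>) \<tau>)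
                 \<le> L * norm (apply_bcontfun Y \<tau> - apply_bcontfun Z \<tau>)"
              proof
                assume "norm (f (apply_bcontfun Y \<tau>) \<tau> - f (apply_bcontfun Z \<tau>) \<tau>)
                 \<le> L * norm (apply_bcontfun Y \<tau> - apply_bcontfun Z \<tau>)"
                also have "\<dots> \<le> L * ?D"
                  using R(3) dist_bounded[of Y \<tau> Z] by (intro mult_left_mono) (auto simp: dist_norm)
                finally have "\<bar>?d \<tau>\<bar> \<le> L * ?D" unfolding d using component_le_norm_cart order_trans by blast
                then show False using \<tau>(3) by simp
              qed
              moreover have "\<tau> \<in> {b - \<delta>..b + \<delta>} \<inter> J" using \<open>b < \<tau>\<close> \<tau> c IJ' R(2) by auto
              ultimately show "\<tau> \<in> {\<tau>\<in>{b - \<delta>..b + \<delta>} \<inter> J.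
                \<not> (\<forall>x1\<in>cball (q b) R. \<forall>x2\<in>cball (q b) R. norm (f x2 \<tau> - f x1 \<tau>) \<le> L * norm (x2 - x1))}"
                using SD(2)[OF YZ(1), of \<tau>] SD(2)[OF YZ(2), of \<tau>] by blast
            qed
          qed
        qed (use order[of i] ab R(3) M(1) in auto)
        ultimately show "\<bar>(V Y ?s - V Z ?s) $ i\<bar> \<le> L * ?D * ((?s - b) powr (\<alpha> $ i) / Gamma (\<alpha> $ i + 1))" by simp
      qed
      also have "\<dots> = L * ?D * \<phi> (?s - b)" by (simp add: \<phi>_def sum_distrib_left)
      also have "\<dots> \<le> L * ?D * \<phi> h"
        using clamp[of t] R(3) by (intro mult_left_mono \<phi>_mono) (auto simp: c_def)
      also have "\<dots> = (L * \<phi> h) * ?D" by simp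
      also have "\<dots> \<le> 1 / 2 * ?D" by (intro mult_right_mono \<phi>L) simp
      finally show "dist (apply_bcontfun (P Y) t) (apply_bcontfun (P Z) t) \<le> 1 / 2 * dist Y Z"
        using P YZ by (simp add: dist_norm)
    qed
  qed auto
  then obtain Y where Y: "Y \<in> S" "P Y = Y" by blast
  \<comment> \<open>On \<open>(b, c]\<close> clamping is the identity, and the fixed point equation
    is the Volterra equation; up to \<open>b\<close> it is the equation already satisfied by
    \<open>q\<close>.\<close>
  have glue_V: "glue Y t = V Y t" if "t \<in> {a..c}" for t
  proof (cases "t \<le> b")
    case True
    then show ?thesis using V_q[of t Y] that by (simp add: glue_def)
  next
    case False
    then have "clamp t = t" using that by (simp add: clamp_def)
    then show ?thesis using False P[OF Y(1), of t] Y(2) by (simp add: glue_def)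
  qed
  have "local_solution \<Omega> J f \<alpha> a qa (glue Y) {a..c}"
    unfolding local_solution_iff[OF I' IJ']
  proof (intro conjI ballI allI glue_cont[OF Y(1)])
    show "glue Y t \<in> \<Omega>" if "t \<in> {a..c}" for t using glue_K[OF Y(1) that] K(2) by blast
    show "glue Y t $ i = qa $ i + rl_integral_raw (\<alpha> $ i) a (\<lambda>s. f (glue Y s) s $ i) t" if "t \<in> {a..c}" for t i
      using glue_V[OF that] by (simp add: V_def g_def[abs_def])
  qed
  then show thesis by (rule that[OF c(1)]) (simp add: glue_def)
qed

text \<open>A time \<open>T\<close> of \<open>J\<close> outside \<open>I\<close> lies above all of
  \<open>I\<close>, so \<open>b = Sup I\<close> exists and belongs to \<open>J\<close>. If
  \<open>b\<close> is in \<open>I\<close>, then \<open>b < T\<close> leaves room to extend beyond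
  \<open>b\<close>; if not, \<open>I\<close> is half-open, and a solution confined to a compact
  \<open>K\<close> would extend to \<open>b\<close>. Either extension contradicts
  maximality.\<close>

lemma maximal_solution_alternative:
  assumes max: "maximal_solution \<Omega> J f \<alpha> a qa q I"
  shows "I = J \<or>
    (\<exists>b\<in>J. a < b \<and> I = {a..<b} \<and> (\<forall>K. compact K \<and> K \<subseteq> \<Omega> \<longrightarrow> (\<exists>t\<in>I. q t \<notin> K)))"
proof (cases "I = J")
  case False
  have sol: "local_solution \<Omega> J f \<alpha> a qa q I"
    and ext: "\<And>q' I'. local_solution \<Omega> J f \<alpha> a qa q' I' \<Longrightarrow> I \<subseteq> I' \<Longrightarrow> (\<And>t. t \<in> I \<Longrightarrow> q' t = q t) \<Longrightarrow> I' = I"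
    using max unfolding maximal_solution_def by blast+
  have I: "I \<in> intervals_from a" "I \<subseteq> J" using sol by (auto simp: local_solution_def)
  obtain T where T: "T \<in> J" "T \<notin> I" using False I(2) by blast
  have below: "t < T" if "t \<in> I" for t
    using intervals_fromD(4)[OF I(1) that] intervals_fromD(3)[OF J T(1)] T(2) by (meson atLeastAtMost_iff not_less subsetD)
  define b where "b = Sup I"
  have bdd: "bdd_above I" using below by (meson bdd_above.I less_imp_le)
  have ne: "I \<noteq> {}" using intervals_fromD(1)[OF I(1)] by blast
  have le_b: "t \<le> b" if "t \<in> I" for t unfolding b_def using that bdd by (rule cSup_upper)
  have "a < b" using intervals_fromD(5)[OF I(1)] le_b by force
  have "b \<le> T" unfolding b_def using ne below by (intro cSup_least) (auto intro: less_imp_le)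
  have bJ: "b \<in> J" using intervals_fromD(4)[OF J T(1)] \<open>a < b\<close> \<open>b \<le> T\<close> by auto
  have below_b: "t \<in> I" if t: "a \<le> t" "t < b" for t
  proof -
    obtain s where "s \<in> I" "t < s" using t(2) less_cSup_iff[OF ne bdd] unfolding b_def by blast
    then show ?thesis using intervals_fromD(4)[OF I(1), of s] t(1) by auto
  qed
  show ?thesis
  proof (cases "b \<in> I")
    case True
    have Ib: "I = {a..b}" using le_b intervals_fromD(3,4)[OF I(1)] True by fastforce
    obtain c q' where *: "b < c" "local_solution \<Omega> J f \<alpha> a qa q' {a..c}" "\<And>t. t \<in> {a..b} \<Longrightarrow> q' t = q t"
      using extend_beyond[OF \<open>a < b\<close> T(1) below[OF True]] sol Ib by metis
    have "{a..c} = I" by (rule ext[OF *(2)]) (use * Ib in auto)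
    then have "c \<in> I" using *(1) \<open>a < b\<close> by auto
    then show ?thesis using Ib *(1) by simp
  next
    case False
    have Ib: "I = {a..<b}"
    proof (intro equalityI subsetI)
      fix t assume "t \<in> I"
      then show "t \<in> {a..<b}" using le_b[of t] intervals_fromD(3)[OF I(1)] False by (cases "t = b") auto
    qed (use below_b in auto)
    have "\<exists>t\<in>I. q t \<notin> K" if K: "compact K" "K \<subseteq> \<Omega>" for K
    proof (rule ccontr)
      assume "\<not> (\<exists>t\<in>I. q t \<notin> K)"
      then have "\<And>t. t \<in> {a..<b} \<Longrightarrow> q t \<in> K" using Ib by blast
      then obtain q' where *: "local_solution \<Omega> J f \<alpha> a qa q' {a..b}" "\<And>t. t \<in> {a..<b} \<Longrightarrow> q' t = q t"
        using extend_to_right_end[OF \<open>a < b\<close> bJ sol[unfolded Ib] K] by metis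
      have "{a..b} = I" by (rule ext[OF *(1)]) (use * Ib in auto)
      then show False using False \<open>a < b\<close> by auto
    qed
    then show ?thesis using Ib bJ \<open>a < b\<close> by blast
  qed
qed simp

end

theorem theorem4:
  fixes a :: real and J :: "real set" and \<Omega> :: "(real ^ 'n) set"
    and f :: "real ^ 'n \<Rightarrow> real \<Rightarrow> real ^ 'n" and qa \<alpha> :: "real ^ 'n"
    and q :: "real \<Rightarrow> real ^ 'n" and I :: "real set"
  assumes "J \<in> intervals_from a"
    and "open \<Omega>" and "\<Omega> \<noteq> {}"
    and "caratheodory \<Omega> J f"
    and "qa \<in> \<Omega>"
    and "\<And>i. 0 < \<alpha> $ i \<and> \<alpha> $ i \<le> 1"
    and "\<And>K c d. compact K \<Longrightarrow> K \<subseteq> \<Omega> \<Longrightarrow> {c..d} \<subseteq> J \<Longrightarrow>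
           \<exists>M\<ge>0. \<forall>x\<in>K. AE t in lebesgue_on {c..d}. norm (f x t) \<le> M"
    and "\<And>x t. x \<in> \<Omega> \<Longrightarrow> t \<in> J \<Longrightarrow>
           \<exists>R>0. \<exists>\<delta>>0. \<exists>L\<ge>0. cball x R \<subseteq> \<Omega> \<and>
             (\<forall>x1\<in>cball x R. \<forall>x2\<in>cball x R.
                AE \<tau> in lebesgue_on ({t - \<delta>..t + \<delta>} \<inter> J).
                  norm (f x2 \<tau> - f x1 \<tau>) \<le> L * norm (x2 - x1))"
    and "maximal_solution \<Omega> J f \<alpha> a qa q I"
  shows "I = J \<or>
    (\<exists>b\<in>J. a < b \<and> I = {a..<b} \<and> (\<forall>K. compact K \<and> K \<subseteq> \<Omega> \<longrightarrow> (\<exists>t\<in>I. q t \<notin> K)))"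
proof -
  interpret caputo_problem a J \<Omega> f qa \<alpha>
    using assms(1,2,4,6-8) by unfold_locales
  show ?thesis by (rule maximal_solution_alternative[OF assms(9)])
qed

end
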